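(* Let $K$ be a field and let $\Delta_1,\Delta_2$ be simplicial complexes with disjoint finite vertex sets $V_1$ and $V_2$, respectively. (a) Suppose that $\Delta_1\circ\Delta_2$ is rigid and that $I_{\Delta_i}\neq0$ for $i=1,2$. Then $\Delta_1$ and $\Delta_2$ are rigid. (b) Conversely, suppose that $\Delta_1$ and $\Delta_2$ are rigid. Then $\Delta_1\circ\Delta_2$ is rigid if and only if for $j=1$ or $j=2$ (at least one), $\mathrm{link}_{\Delta_j}F$ is not special for all $F\in\Delta_j$. In algebraic terms, the latter condition says: for $j=1$ or $j=2$, none of the monomial localizations of $I_{\Delta_j}$ is of the form $zP$, where $z$ is a variable of $S_j$ with $z\notin P$, or where $P=S_j$; that is, of the form $zP$ with $z$ a variable and $P$ either a nonzero monomial prime ideal with $z\notin P$ or the unit ideal.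
   Context: A simplicial complex $\Delta$ on a finite vertex set $V$ is a collection of subsets of $V$ closed under taking subsets and containing $\emptyset$; not every $\{v\}$, $v\in V$, need be a face. Facets are the maximal faces. Let $S$ be the polynomial ring over $K$ with variables $x_v$, $v\in V$ (denoted $S_j$ when $V=V_j$). The Stanley--Reisner ideal $I_\Delta\subseteq S$ is generated by the monomials $\prod_{v\in N}x_v$ with $N\subseteq V$, $N\notin\Delta$; $K[\Delta]=S/I_\Delta$. $T^1(\Delta)$ is the cokernel of $\delta^*:\mathrm{Der}_K(S)\to\mathrm{Hom}_S(I_\Delta,S/I_\Delta)$, $\delta^*(\partial)(f)=\partial f+I_\Delta$. $\Delta$ is rigid if $T^1(\Delta)=0$. The circ $\Delta_1\circ\Delta_2$ is the simplicial complex on $V_1\cup V_2$ whose faces are the subsets $F\subseteq V_1\cup V_2$ such that $F\cap V_1\in\Delta_1$ or $F\cap V_2\in\Delta_2$ (or both). For $F\in\Delta$, $\mathrm{link}_\Delta F=\{G\in\Delta: G\cap F=\emptyset,\ G\cup F\in\Delta\}$, with vertex set $V\setminus F$. A simplicial complex $\Delta$ on vertex set $V$ is special if either $\Delta$ has a unique facet and this facet is a maximal proper subset of $V$ (i.e. $V\setminus\{i\}$ for some $i\in V$), or $\Delta$ has exactly two facets, namely $\{i\}$ and $V\setminus\{i\}$ for some $i\in V$. A monomial prime ideal is an ideal generated by a set of variables. For a monomial ideal $I\subseteq S$ and a monomial prime ideal $P_A=(x_i:i\in A)$, the monomial localization of $I$ with respect to $P_A$ is the monomial ideal $I(P_A)\subseteq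 K[x_i:i\in A]$ obtained from $I$ by substituting $x_i\mapsto1$ for all $i\notin A$. In the algebraic reformulation, the ideals $zP$ are understood as ideals of the polynomial ring in which the monomial localization lives. *)

theory Defs
  imports "HOL-Library.Poly_Mapping" "HOL-Algebra.Ring" "HOL-Algebra.QuotRing" "HOL-Algebra.Module"
begin

text \<open>Polynomials with exponent vectors \<open>'v \<Rightarrow>\<^sub>0 nat\<close>; the product is the convolution product
  of \<^theory>\<open>HOL-Library.Poly_Mapping\<close>.\<close>

type_synonym ('v, 'k) mpoly = "('v \<Rightarrow>\<^sub>0 nat) \<Rightarrow>\<^sub>0 'k"

definition Var :: "'v \<Rightarrow> ('v, 'k::field) mpoly" where
  "Var v = Poly_Mapping.single (Poly_Mapping.single v 1) 1"

definition Const :: "'k::field \<Rightarrow> ('v, 'k) mpoly" where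
  "Const c = Poly_Mapping.single 0 c"

definition poly_ring :: "'v set \<Rightarrow> ('v, 'k::field) mpoly ring" where
  "poly_ring V =
     \<lparr>carrier = {p. \<forall>m \<in> Poly_Mapping.keys p. Poly_Mapping.keys m \<subseteq> V},
      mult = (*), one = 1, zero = 0, add = (+)\<rparr>"

text \<open>The \<open>K\<close>-algebra endomorphism with \<open>x\<^sub>v \<mapsto> \<sigma> v\<close>.\<close>

definition subst_vars ::
    "('v \<Rightarrow> ('v, 'k) mpoly) \<Rightarrow> ('v, 'k::field) mpoly \<Rightarrow> ('v, 'k) mpoly" where
  "subst_vars \<sigma> p =
     (\<Sum>m \<in> Poly_Mapping.keys p. Const (Poly_Mapping.lookup p m) *
        (\<Prod>v \<in> Poly_Mapping.keys m. \<sigma> v ^ Poly_Mapping.lookup m v))"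


section \<open>Simplicial complexes\<close>

definition simplicial_complex :: "'v set \<Rightarrow> 'v set set \<Rightarrow> bool" where
  "simplicial_complex V \<Delta> \<longleftrightarrow>
     finite V \<and> \<Delta> \<subseteq> Pow V \<and> {} \<in> \<Delta> \<and> (\<forall>F\<in>\<Delta>. \<forall>G. G \<subseteq> F \<longrightarrow> G \<in> \<Delta>)"

definition facets :: "'v set set \<Rightarrow> 'v set set" where
  "facets \<Delta> = {F \<in> \<Delta>. \<forall>G\<in>\<Delta>. F \<subseteq> G \<longrightarrow> G = F}"

definition link :: "'v set set \<Rightarrow> 'v set \<Rightarrow> 'v set set" where
  "link \<Delta> F = {G \<in> \<Delta>. G \<inter> F = {} \<and> G \<union> F \<in> \<Delta>}"

definition circ :: "'v set \<Rightarrow> 'v set set \<Rightarrow> 'v set \<Rightarrow> 'v set set \<Rightarrow> 'v set set" where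
  "circ V1 \<Delta>1 V2 \<Delta>2 = {F. F \<subseteq> V1 \<union> V2 \<and> (F \<inter> V1 \<in> \<Delta>1 \<or> F \<inter> V2 \<in> \<Delta>2)}"

text \<open>In the second case the two facets are automatically distinct.\<close>

definition special :: "'v set \<Rightarrow> 'v set set \<Rightarrow> bool" where
  "special V \<Delta> \<longleftrightarrow>
     (\<exists>i\<in>V. facets \<Delta> = {V - {i}}) \<or> (\<exists>i\<in>V. facets \<Delta> = {{i}, V - {i}})"


section \<open>Stanley--Reisner ideals and the first cotangent cohomology\<close>

definition SR_ideal :: "'v set \<Rightarrow> 'v set set \<Rightarrow> ('v, 'k::field) mpoly set" where
  "SR_ideal V \<Delta> = genideal (poly_ring V) {\<Prod>v\<in>N. Var v | N. N \<subseteq> V \<and> N \<notin> \<Delta>}"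

definition Der :: "'v set \<Rightarrow> (('v, 'k::field) mpoly \<Rightarrow> ('v, 'k) mpoly) set" where
  "Der V = {D \<in> carrier (poly_ring V) \<rightarrow>\<^sub>E carrier (poly_ring V).
     (\<forall>f \<in> carrier (poly_ring V). \<forall>g \<in> carrier (poly_ring V).
        D (f + g) = D f + D g \<and> D (f * g) = f * D g + g * D f) \<and>
     (\<forall>c. \<forall>f \<in> carrier (poly_ring V). D (Const c * f) = Const c * D f)}"

text \<open>The \<open>R\<close>-module \<open>Hom\<^sub>R(I, R/I)\<close>. Its elements are extensional functions on \<open>I\<close>; the fields
  \<open>mult\<close> and \<open>one\<close> of the module record carry no information.\<close>

definition Hom_Quot ::
    "('a, 'm) ring_scheme \<Rightarrow> 'a set \<Rightarrow> ('a, 'a \<Rightarrow> 'a set) module" where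
  "Hom_Quot R I =
     \<lparr>carrier = {\<phi> \<in> I \<rightarrow>\<^sub>E carrier (R Quot I).
        (\<forall>f\<in>I. \<forall>g\<in>I. \<phi> (f \<oplus>\<^bsub>R\<^esub> g) = \<phi> f \<oplus>\<^bsub>R Quot I\<^esub> \<phi> g) \<and>
        (\<forall>s\<in>carrier R. \<forall>f\<in>I. \<phi> (s \<otimes>\<^bsub>R\<^esub> f) = (I +>\<^bsub>R\<^esub> s) \<otimes>\<^bsub>R Quot I\<^esub> \<phi> f)},
      mult = undefined, one = undefined,
      zero = (\<lambda>f\<in>I. \<zero>\<^bsub>R Quot I\<^esub>),
      add = (\<lambda>\<phi> \<psi>. \<lambda>f\<in>I. \<phi> f \<oplus>\<^bsub>R Quot I\<^esub> \<psi> f),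
      smult = (\<lambda>s \<phi>. \<lambda>f\<in>I. (I +>\<^bsub>R\<^esub> s) \<otimes>\<^bsub>R Quot I\<^esub> \<phi> f)\<rparr>"

definition delta_star ::
    "'v set \<Rightarrow> 'v set set \<Rightarrow> (('v, 'k::field) mpoly \<Rightarrow> ('v, 'k) mpoly)
      \<Rightarrow> ('v, 'k) mpoly \<Rightarrow> ('v, 'k) mpoly set" where
  "delta_star V \<Delta> D = (\<lambda>f \<in> SR_ideal V \<Delta>. SR_ideal V \<Delta> +>\<^bsub>poly_ring V\<^esub> D f)"

text \<open>Only the underlying abelian group of the cokernel is recorded, written multiplicatively as a
  factor group; this suffices to express vanishing.\<close>

definition T1 ::
    "'v set \<Rightarrow> 'v set set \<Rightarrow> (('v, 'k::field) mpoly \<Rightarrow> ('v, 'k) mpoly set) set monoid" where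
  "T1 V \<Delta> = add_monoid (Hom_Quot (poly_ring V) (SR_ideal V \<Delta>)) Mod (delta_star V \<Delta> ` Der V)"

definition rigid :: "'k::field itself \<Rightarrow> 'v set \<Rightarrow> 'v set set \<Rightarrow> bool" where
  "rigid K V \<Delta> \<longleftrightarrow>
     (let T = (T1 V \<Delta> :: (('v, 'k) mpoly \<Rightarrow> ('v, 'k) mpoly set) set monoid)
      in carrier T = {\<one>\<^bsub>T\<^esub>})"


section \<open>Monomial localizations\<close>

text \<open>The monomial localization at \<open>P\<^sub>A\<close>, an ideal of \<open>K[x\<^sub>i : i \<in> A]\<close>. As the substitution maps
  onto this ring, the image of an ideal is already an ideal.\<close>

definition mono_localization ::
    "('v, 'k::field) mpoly set \<Rightarrow> 'v set \<Rightarrow> ('v, 'k) mpoly set" where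
  "mono_localization I A =
     genideal (poly_ring A) (subst_vars (\<lambda>i. if i \<in> A then Var i else 1) ` I)"

definition monomial_prime :: "'v set \<Rightarrow> ('v, 'k::field) mpoly set \<Rightarrow> bool" where
  "monomial_prime A P \<longleftrightarrow> (\<exists>B\<subseteq>A. P = genideal (poly_ring A) (Var ` B))"

text \<open>The ideal \<open>J\<close> of \<open>K[x\<^sub>i : i \<in> A]\<close> has the form \<open>zP\<close> with \<open>z\<close> a variable and \<open>P\<close> either a nonzero
  monomial prime ideal not containing \<open>z\<close> or the unit ideal.\<close>

definition var_times_prime :: "'v set \<Rightarrow> ('v, 'k::field) mpoly set \<Rightarrow> bool" where
  "var_times_prime A J \<longleftrightarrow>
     (\<exists>z\<in>A. \<exists>P.
        (monomial_prime A P \<and> P \<noteq> {0} \<and> Var z \<notin> P \<or> P = carrier (poly_ring A)) \<and>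
        J = (\<lambda>p. Var z * p) ` P)"

end

theory Submission
  imports Defs
begin

text \<open>\<open>I\<close> being a monomial ideal, \<open>Hom(I, S/I)\<close> is \<open>\<int>\<^sup>V\<close>-graded, so rigidity can be tested degree by degree,
  where it becomes a combinatorial condition on functions on sets of faces (\<open>comb_rigid\<close>). For the circ
  these functions live on \<open>D\<^sub>1 \<times> U\<^sub>2 \<union> U\<^sub>1 \<times> D\<^sub>2\<close>, with \<open>D\<^sub>j \<subseteq> U\<^sub>j\<close> families of subsets of \<open>V\<^sub>j\<close>; rigidity
  of \<open>\<Delta>\<^sub>1\<close> and \<open>\<Delta>\<^sub>2\<close> makes them constant on both pieces, and the remaining obstruction to vanishing,
  in degrees with \<open>B \<inter> V\<^sub>1 \<noteq> {} \<noteq> B \<inter> V\<^sub>2\<close>, is absent as soon as \<open>V\<^sub>1 - {v} \<notin> \<Delta>\<^sub>1\<close> for all \<open>v\<close>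
  or \<open>V\<^sub>2 - {v} \<notin> \<Delta>\<^sub>2\<close> for all \<open>v\<close>.
  Both the condition on links and the condition on localizations say exactly this for a complex that is
  not a full simplex: if \<open>I = x\<^sub>i J\<close> with \<open>J \<noteq> 0\<close>, then localizing at a minimal prime \<open>P\<close> of \<open>J\<close>
  together with \<open>x\<^sub>i\<close> turns \<open>I\<close> into \<open>x\<^sub>i P\<close>.\<close>

text \<open>The grading is used only through coefficients. A homomorphism is tested on pairs of a
  monomial x^m in I and an exponent n supported on a face; all other n are absorbed by I. Cancelling
  the gcd of x^m and x^n leaves exponents b and a with disjoint supports, which is the degree a - b.
  To show that a homomorphism comes from a derivation, polynomials h_v are assembled from the values
  it takes in the degrees a - e_v; finiteness of their supports is the one global point. In every
  pair that matters there x_v occurs in x^m exactly once, so differentiating produces the factor 1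
  and the characteristic of K never enters. The ideal of the circ is the product I_1 I_2. If x_i
  divides I_1 and x_j divides I_2, both nonzero, then f -> f/(x_i x_j) is a homomorphism that no
  derivation induces: this is the obstruction. Otherwise one side, say the first, has all V1 - {v}
  as nonfaces, and a set with such a trace remains a nonface when v is dropped from B. That forces
  the constant on one piece to be 0, and the two pieces are then compared at a common point or
  treated alike.\<close>

abbreviation "lookup \<equiv> Poly_Mapping.lookup"
abbreviation "keys \<equiv> Poly_Mapping.keys"
abbreviation "single \<equiv> Poly_Mapping.single"

section \<open>Polynomials\<close>

text \<open>The polynomial ring over V and all monomial ideals below consist of the polynomials
  whose exponents lie in some set M. Carrying M through the induction makes one principle serve for
  all of them.\<close>

lemma mpoly_induct [consumes 1, case_names zero single add]:
  fixes p :: "'a \<Rightarrow>\<^sub>0 'b::comm_monoid_add"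
  assumes "keys p \<subseteq> M"
    and "P 0"
    and "\<And>m c. m \<in> M \<Longrightarrow> P (single m c)"
    and add: "\<And>p q. keys p \<subseteq> M \<Longrightarrow> keys q \<subseteq> M \<Longrightarrow> P p \<Longrightarrow> P q \<Longrightarrow> P (p + q)"
  shows "P p"
proof -
  have "finite X \<Longrightarrow> X \<subseteq> M \<Longrightarrow> P (\<Sum>m\<in>X. single m (lookup p m)) \<and>
      keys (\<Sum>m\<in>X. single m (lookup p m)) \<subseteq> M" for X
  proof (induction X rule: finite_induct)
    case (insert m X)
    have "keys (single m (lookup p m)) \<subseteq> M"
      using insert.prems by auto
    moreover have "keys (single m (lookup p m) + (\<Sum>m\<in>X. single m (lookup p m))) \<subseteq> M"
      using insert keys_add[of "single m (lookup p m)" "\<Sum>m\<in>X. single m (lookup p m)"]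
      by (auto split: if_splits)
    ultimately show ?case
      using insert assms(3) add by simp
  qed (use assms(2) in auto)
  moreover have "p = (\<Sum>m\<in>keys p. single m (lookup p m))"
  proof (rule poly_mapping_eqI)
    fix k
    have "lookup (\<Sum>m\<in>keys p. single m (lookup p m)) k
        = (\<Sum>m\<in>keys p. if m = k then lookup p k else 0)"
      unfolding lookup_sum by (intro sum.cong) (auto simp: lookup_single when_def)
    also have "\<dots> = lookup p k"
      by (simp add: in_keys_iff)
    finally show "lookup p k = lookup (\<Sum>m\<in>keys p. single m (lookup p m)) k" ..
  qed
  ultimately show ?thesis
    using assms(1) by (metis finite_keys)
qed

lemmas mpoly_induct_all = mpoly_induct[OF subset_UNIV, simplified, case_names zero single add]

lemma nat_poly_mapping_eq_add_iff:
  fixes e m n :: "'v \<Rightarrow>\<^sub>0 nat"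
  shows "e + m = n \<longleftrightarrow> (\<forall>v. lookup e v \<le> lookup n v) \<and> m = n - e"
  by (auto simp: poly_mapping_eq_iff lookup_add lookup_minus fun_eq_iff)
    (metis le_add1, metis diff_add_inverse)

text \<open>Subtraction of exponents is truncated, hence the explicit divisibility test.\<close>

lemma lookup_single_mult:
  fixes p :: "('v, 'k::field) mpoly"
  shows "lookup (single e c * p) n =
    (if \<forall>v. lookup e v \<le> lookup n v then c * lookup p (n - e) else 0)"
proof (induction p rule: mpoly_induct_all)
  case (single m d)
  show ?case
    using nat_poly_mapping_eq_add_iff[of e m n]
    by (auto simp: mult_single lookup_single when_def)
next
  case (add p q)
  then show ?case
    by (simp add: distrib_left lookup_add)
qed auto

lemma keys_add_nat [simp]:
  fixes m n :: "'v \<Rightarrow>\<^sub>0 nat"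
  shows "keys (m + n) = keys m \<union> keys n"
  by (auto simp: in_keys_iff lookup_add)

text \<open>Partial derivatives, substitutions of variables and the homomorphism rebuilt from a
  function on faces are all given by their values T on monomials; this is their common K-linear
  extension.\<close>

definition linext :: "(('v \<Rightarrow>\<^sub>0 nat) \<Rightarrow> ('v, 'k) mpoly) \<Rightarrow> ('v, 'k::field) mpoly \<Rightarrow> ('v, 'k) mpoly" where
  "linext T p = (\<Sum>m\<in>keys p. Const (lookup p m) * T m)"

lemma Const_0 [simp]: "Const 0 = 0" and Const_1 [simp]: "Const 1 = 1"
  by (simp_all add: Const_def)

lemma Const_add: "Const (a + b) = Const a + Const b"
  by (simp add: Const_def single_add)

lemma Const_mult: "Const (a * b) = Const a * Const b"
  by (simp add: Const_def mult_single)

lemma Const_mult_single: "Const a * single m b = single m (a * b)"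
  by (simp add: Const_def mult_single)

lemma linext_superset:
  assumes "finite X" "keys p \<subseteq> X"
  shows "linext T p = (\<Sum>m\<in>X. Const (lookup p m) * T m)"
  unfolding linext_def using assms
  by (intro sum.mono_neutral_left) (auto simp: in_keys_iff)

lemma linext_0 [simp]: "linext T 0 = 0"
  by (simp add: linext_def)

lemma linext_single [simp]: "linext T (single m c) = Const c * T m"
  by (subst linext_superset[of "{m}"]) auto

lemma linext_add: "linext T (p + q) = linext T p + linext T q"
  using keys_add[of p q]
  by (simp add: linext_superset[of "keys p \<union> keys q"] lookup_add Const_add distrib_right sum.distrib)

lemma linext_Const_mult: "linext T (Const c * p) = Const c * linext T p"
proof (induction p rule: mpoly_induct_all)
  case (add p q)
  then show ?case
    by (simp add: distrib_left linext_add)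
qed (auto simp: Const_mult_single Const_mult algebra_simps)

section \<open>The polynomial ring over V as a commutative ring\<close>

lemma carrier_poly_ring_iff: "p \<in> carrier (poly_ring V) \<longleftrightarrow> (\<forall>m\<in>keys p. keys m \<subseteq> V)"
  by (simp add: poly_ring_def)

lemma poly_ring_simps [simp]:
  "monoid.mult (poly_ring V) = (*)" "one (poly_ring V) = 1"
  "zero (poly_ring V) = 0" "add (poly_ring V) = (+)"
  by (simp_all add: poly_ring_def)

lemma carrier_add:
  assumes "p \<in> carrier (poly_ring V)" "q \<in> carrier (poly_ring V)"
  shows "p + q \<in> carrier (poly_ring V)"
  using assms keys_add[of p q] by (auto simp: carrier_poly_ring_iff)

lemma carrier_mult:
  assumes "p \<in> carrier (poly_ring V)" "q \<in> carrier (poly_ring V)"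
  shows "p * q \<in> carrier (poly_ring V)"
  unfolding carrier_poly_ring_iff
proof
  fix m
  assume "m \<in> keys (p * q)"
  then obtain a b where "m = a + b" "a \<in> keys p" "b \<in> keys q"
    using keys_mult[of p q] by blast
  then show "keys m \<subseteq> V"
    using assms by (auto simp: carrier_poly_ring_iff)
qed

lemma carrier_uminus: "p \<in> carrier (poly_ring V) \<Longrightarrow> - p \<in> carrier (poly_ring V)"
  by (simp add: carrier_poly_ring_iff)

lemma carrier_minus:
  "p \<in> carrier (poly_ring V) \<Longrightarrow> q \<in> carrier (poly_ring V) \<Longrightarrow> p - q \<in> carrier (poly_ring V)"
  using carrier_add[of p V "- q"] by (simp add: carrier_uminus)

lemma carrier_0 [simp]: "0 \<in> carrier (poly_ring V)"
  by (simp add: carrier_poly_ring_iff)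

lemma carrier_single: "keys m \<subseteq> V \<Longrightarrow> single m c \<in> carrier (poly_ring V)"
  by (simp add: carrier_poly_ring_iff)

lemma carrier_Const [simp]: "Const c \<in> carrier (poly_ring V)"
  by (simp add: Const_def carrier_single)

lemma carrier_1 [simp]: "1 \<in> carrier (poly_ring V)"
  using carrier_Const[of 1] by simp

lemma carrier_Var: "v \<in> V \<Longrightarrow> Var v \<in> carrier (poly_ring V)"
  by (simp add: Var_def carrier_single)

lemma carrier_sum: "(\<And>x. x \<in> X \<Longrightarrow> f x \<in> carrier (poly_ring V)) \<Longrightarrow> sum f X \<in> carrier (poly_ring V)"
  by (induction X rule: infinite_finite_induct) (auto intro: carrier_add)

lemma carrier_linext:
  "p \<in> carrier (poly_ring V) \<Longrightarrow> (\<And>m. keys m \<subseteq> V \<Longrightarrow> T m \<in> carrier (poly_ring V)) \<Longrightarrow>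
    linext T p \<in> carrier (poly_ring V)"
  unfolding linext_def carrier_poly_ring_iff[of p] by (intro carrier_sum carrier_mult) auto

lemma cring_poly_ring: "cring (poly_ring V :: ('v, 'k::field) mpoly ring)"
proof (rule cringI)
  show "abelian_group (poly_ring V :: ('v, 'k::field) mpoly ring)"
  proof (rule abelian_groupI)
    fix x :: "('v, 'k) mpoly"
    assume "x \<in> carrier (poly_ring V)"
    then show "\<exists>y\<in>carrier (poly_ring V). y \<oplus>\<^bsub>poly_ring V\<^esub> x = \<zero>\<^bsub>poly_ring V\<^esub>"
      by (intro bexI[of _ "- x"]) (auto simp: carrier_uminus)
  qed (auto intro: carrier_add simp: algebra_simps)
  show "comm_monoid (poly_ring V :: ('v, 'k::field) mpoly ring)"
    by (rule comm_monoidI) (auto intro: carrier_mult simp: algebra_simps)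
qed (auto simp: algebra_simps)

section \<open>Monomial ideals determined by supports\<close>

text \<open>One format for all ideals that occur: N is the set of nonfaces for a Stanley-Reisner
  ideal, the sets meeting B for the prime generated by the variables in B, the sets that become
  nonfaces after adding V - A for a localization, and \<open>UNIV\<close> for the whole ring. Only
  members of N inside V count, so N may be a complement such as \<open>- \<Delta>\<close>.\<close>

definition supp_ideal :: "'v set \<Rightarrow> 'v set set \<Rightarrow> ('v, 'k::field) mpoly set" where
  "supp_ideal V N = {p. \<forall>m\<in>keys p. keys m \<subseteq> V \<and> keys m \<in> N}"

definition upset_on :: "'v set \<Rightarrow> 'v set set \<Rightarrow> bool" where
  "upset_on V N \<longleftrightarrow> (\<forall>F G. F \<in> N \<longrightarrow> F \<subseteq> G \<longrightarrow> G \<subseteq> V \<longrightarrow> G \<in> N)"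

lemma supp_ideal_carrier: "p \<in> supp_ideal V N \<Longrightarrow> p \<in> carrier (poly_ring V)"
  by (simp add: supp_ideal_def carrier_poly_ring_iff)

lemma supp_ideal_add: "p \<in> supp_ideal V N \<Longrightarrow> q \<in> supp_ideal V N \<Longrightarrow> p + q \<in> supp_ideal V N"
  using keys_add[of p q] by (auto simp: supp_ideal_def)

lemma supp_ideal_uminus: "p \<in> supp_ideal V N \<Longrightarrow> - p \<in> supp_ideal V N"
  by (auto simp: supp_ideal_def)

lemma supp_ideal_0 [simp]: "0 \<in> supp_ideal V N"
  by (auto simp: supp_ideal_def)

lemma supp_ideal_single: "keys m \<subseteq> V \<Longrightarrow> keys m \<in> N \<Longrightarrow> single m c \<in> supp_ideal V N"
  by (auto simp: supp_ideal_def)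

lemma supp_ideal_mult:
  assumes "upset_on V N" "p \<in> carrier (poly_ring V)" "q \<in> supp_ideal V N"
  shows "p * q \<in> supp_ideal V N"
  unfolding supp_ideal_def
proof (clarify, intro conjI)
  fix m
  assume "m \<in> keys (p * q)"
  then obtain a b where ab: "m = a + b" "a \<in> keys p" "b \<in> keys q"
    using keys_mult[of p q] by blast
  then show V: "keys m \<subseteq> V"
    using assms by (auto simp: carrier_poly_ring_iff supp_ideal_def)
  show "keys m \<in> N"
    using ab V assms(1,3) unfolding upset_on_def supp_ideal_def by (metis (mono_tags, lifting) Un_upper2 keys_add_nat mem_Collect_eq)
qed

lemma supp_ideal_is_ideal:
  assumes "upset_on V N"
  shows "ideal (supp_ideal V N :: ('v, 'k::field) mpoly set) (poly_ring V)"
proof (rule idealI)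
  interpret cring "poly_ring V :: ('v, 'k) mpoly ring"
    by (rule cring_poly_ring)
  show "ring (poly_ring V :: ('v, 'k) mpoly ring)"
    by (rule ring_axioms)
  show "subgroup (supp_ideal V N :: ('v, 'k) mpoly set) (add_monoid (poly_ring V))"
  proof (rule subgroup.intro)
    fix x :: "('v, 'k) mpoly"
    assume x: "x \<in> supp_ideal V N"
    have "\<ominus>\<^bsub>poly_ring V\<^esub> x = - x"
      by (rule minus_equality) (use x in \<open>auto simp: supp_ideal_carrier carrier_uminus\<close>)
    then show "inv\<^bsub>add_monoid (poly_ring V)\<^esub> x \<in> supp_ideal V N"
      using x by (simp add: a_inv_def supp_ideal_uminus)
  qed (auto simp: supp_ideal_carrier supp_ideal_add)
next
  fix a x :: "('v, 'k) mpoly"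
  assume "a \<in> supp_ideal V N" "x \<in> carrier (poly_ring V)"
  then show "x \<otimes>\<^bsub>poly_ring V\<^esub> a \<in> supp_ideal V N" "a \<otimes>\<^bsub>poly_ring V\<^esub> x \<in> supp_ideal V N"
    using supp_ideal_mult[OF assms] by (simp_all add: mult.commute[of a x])
qed

text \<open>S may be infinite and need not consist of monomials: for a localization it is the whole
  image of an ideal. It is enough that each monomial of the ideal is a multiple of a single element
  of S.\<close>

lemma genideal_eq_supp_ideal:
  fixes S :: "('v, 'k::field) mpoly set"
  assumes "upset_on V N" and sub: "S \<subseteq> supp_ideal V N"
    and gen: "\<And>m. keys m \<subseteq> V \<Longrightarrow> keys m \<in> N \<Longrightarrow> \<exists>q\<in>carrier (poly_ring V). \<exists>s\<in>S. single m 1 = q * s"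
  shows "genideal (poly_ring V) S = supp_ideal V N"
proof (rule subset_antisym)
  interpret cring "poly_ring V :: ('v, 'k) mpoly ring"
    by (rule cring_poly_ring)
  have S: "S \<subseteq> carrier (poly_ring V)"
    using sub supp_ideal_carrier by blast
  show "genideal (poly_ring V) S \<subseteq> supp_ideal V N"
    by (rule genideal_minimal[OF supp_ideal_is_ideal]) fact+
  interpret J: ideal "genideal (poly_ring V) S" "poly_ring V"
    using S by (rule genideal_ideal)
  show "supp_ideal V N \<subseteq> genideal (poly_ring V) S"
  proof
    fix p :: "('v, 'k) mpoly"
    assume "p \<in> supp_ideal V N"
    then have "keys p \<subseteq> {m. keys m \<subseteq> V \<and> keys m \<in> N}"
      by (auto simp: supp_ideal_def)
    then show "p \<in> genideal (poly_ring V) S"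
    proof (induction p rule: mpoly_induct)
      case zero
      show ?case
        using J.zero_closed by simp
    next
      case (single m c)
      then obtain q s where "q \<in> carrier (poly_ring V)" "s \<in> S" "single m 1 = q * s"
        using gen by blast
      moreover have "single m c = Const c * single m 1"
        by (simp add: Const_mult_single)
      moreover have "s \<in> genideal (poly_ring V) S"
        using genideal_self[OF S] \<open>s \<in> S\<close> by blast
      ultimately show ?case
        using J.I_l_closed by (metis carrier_Const poly_ring_simps(1))
    next
      case (add p q)
      then show ?case
        using J.a_closed by simp
    qed
  qed
qed

section \<open>Squarefree monomials and the Stanley-Reisner ideal\<close>

definition ind :: "'v set \<Rightarrow> 'v \<Rightarrow>\<^sub>0 nat" where
  "ind S = (\<Sum>v\<in>S. single v 1)"

lemma lookup_ind: "finite S \<Longrightarrow> lookup (ind S) v = (if v \<in> S then 1 else 0)"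
  by (simp add: ind_def lookup_sum lookup_single when_def)

lemma keys_ind [simp]: "finite S \<Longrightarrow> keys (ind S) = S"
  by (auto simp: in_keys_iff lookup_ind split: if_splits)

lemma prod_Var: "finite S \<Longrightarrow> (\<Prod>v\<in>S. Var v) = single (ind S) 1"
  by (induction S rule: finite_induct) (auto simp: ind_def Var_def mult_single)

lemma ind_singleton [simp]: "ind {v} = single v 1"
  by (simp add: ind_def)

lemma diff_add_ind:
  assumes "finite S" "S \<subseteq> keys m"
  shows "m - ind S + ind S = m"
  using assms by (intro poly_mapping_eqI) (auto simp: lookup_add lookup_minus lookup_ind in_keys_iff Suc_le_eq)

lemma keys_diff_nat: "keys (m - n :: 'v \<Rightarrow>\<^sub>0 nat) \<subseteq> keys m"
  by (auto simp: in_keys_iff lookup_minus)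

lemma SR_ideal_eq:
  assumes "simplicial_complex V \<Delta>"
  shows "SR_ideal V \<Delta> = supp_ideal V (- \<Delta>)"
  unfolding SR_ideal_def
proof (rule genideal_eq_supp_ideal)
  have fin: "finite V" "\<And>N. N \<subseteq> V \<Longrightarrow> finite N"
    using assms finite_subset by (auto simp: simplicial_complex_def)
  show "upset_on V (- \<Delta>)"
    using assms by (auto simp: upset_on_def simplicial_complex_def)
  show "{\<Prod>v\<in>N. Var v |N. N \<subseteq> V \<and> N \<notin> \<Delta>} \<subseteq> supp_ideal V (- \<Delta>)"
    by (fastforce simp: prod_Var fin intro!: supp_ideal_single)
  fix m :: "'a \<Rightarrow>\<^sub>0 nat"
  assume m: "keys m \<subseteq> V" "keys m \<in> - \<Delta>"
  show "\<exists>q\<in>carrier (poly_ring V). \<exists>s\<in>{\<Prod>v\<in>N. Var v |N. N \<subseteq> V \<and> N \<notin> \<Delta>}. single m 1 = q * s"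
  proof (intro bexI)
    show "single m 1 = single (m - ind (keys m)) 1 * (\<Prod>v\<in>keys m. Var v)"
      by (simp add: prod_Var mult_single diff_add_ind)
    show "single (m - ind (keys m)) 1 \<in> carrier (poly_ring V)"
      using m keys_diff_nat[of m "ind (keys m)"] by (intro carrier_single) auto
    show "(\<Prod>v\<in>keys m. Var v) \<in> {\<Prod>v\<in>N. Var v |N. N \<subseteq> V \<and> N \<notin> \<Delta>}"
      using m by auto
  qed
qed

section \<open>Derivations\<close>

text \<open>If v does not occur in m, the truncated exponent \<open>m - single v 1\<close> is m
  itself, but then the coefficient \<open>lookup m v\<close> is 0.\<close>

definition partial :: "'v \<Rightarrow> ('v, 'k::field) mpoly \<Rightarrow> ('v, 'k) mpoly" where
  "partial v = linext (\<lambda>m. single (m - single v 1) (of_nat (lookup m v)))"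

lemma partial_single: "partial v (single m c) = single (m - single v 1) (c * of_nat (lookup m v))"
  by (simp add: partial_def Const_mult_single)

lemma partial_add: "partial v (p + q) = partial v p + partial v q"
  by (simp add: partial_def linext_add)

lemma partial_Const_mult: "partial v (Const c * p) = Const c * partial v p"
  by (simp add: partial_def linext_Const_mult)

lemma partial_Const [simp]: "partial v (Const c) = 0"
  by (simp add: Const_def partial_single)

lemma partial_mult:
  fixes p q :: "('v, 'k::field) mpoly"
  shows "partial v (p * q) = p * partial v q + q * partial v p"
proof (induction p rule: mpoly_induct_all)
  case (single m c)
  show ?case
  proof (induction q rule: mpoly_induct_all)
    case (single n d)
    \<comment> \<open>The truncation can be moved onto one factor only if v occurs in it; otherwise
      the coefficient of that term is 0.\<close>
    have shift: "(m + n) - single v 1 = m + (n - single v 1)" if "lookup n v > 0"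
      for m n :: "'v \<Rightarrow>\<^sub>0 nat"
      using that by (intro poly_mapping_eqI) (auto simp: lookup_add lookup_minus lookup_single when_def)
    have 1: "single (m + n - single v 1) (b * of_nat (lookup n v)) =
        single (m + (n - single v 1)) (b * of_nat (lookup n v))" for b :: 'k
      using shift[of n m] by (cases "lookup n v = 0") auto
    have 2: "single (m + n - single v 1) (b * of_nat (lookup m v)) =
        single (n + (m - single v 1)) (b * of_nat (lookup m v))" for b :: 'k
      using shift[of m n] by (cases "lookup m v = 0") (auto simp: add.commute)
    have "partial v (single m c * single n d) =
        single (m + n - single v 1) ((c * d) * of_nat (lookup n v)) +
        single (m + n - single v 1) ((c * d) * of_nat (lookup m v))"
      by (simp add: mult_single partial_single lookup_add distrib_left add.commute flip: single_add)
    also have "\<dots> = single (m + (n - single v 1)) ((c * d) * of_nat (lookup n v)) +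
        single (n + (m - single v 1)) ((c * d) * of_nat (lookup m v))"
      by (simp only: 1 2)
    also have "\<dots> = single m c * partial v (single n d) + single n d * partial v (single m c)"
      by (simp add: partial_single mult_single mult_ac)
    finally show ?case .
  qed (simp_all add: distrib_left distrib_right partial_add partial_def[of v] linext_add)
qed (simp_all add: distrib_left distrib_right partial_add partial_def[of v] linext_add)

lemma carrier_partial: "p \<in> carrier (poly_ring V) \<Longrightarrow> partial v p \<in> carrier (poly_ring V)"
  unfolding partial_def
  by (rule carrier_linext, assumption, rule carrier_single) (use keys_diff_nat in fast)

definition der_of ::
    "'v set \<Rightarrow> ('v \<Rightarrow> ('v, 'k::field) mpoly) \<Rightarrow> ('v, 'k) mpoly \<Rightarrow> ('v, 'k) mpoly" where
  "der_of V h = (\<lambda>p\<in>carrier (poly_ring V). \<Sum>v\<in>V. h v * partial v p)"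

lemma DerD:
  assumes "D \<in> Der V"
  shows "p \<in> carrier (poly_ring V) \<Longrightarrow> D p \<in> carrier (poly_ring V)"
    and "p \<in> carrier (poly_ring V) \<Longrightarrow> q \<in> carrier (poly_ring V) \<Longrightarrow> D (p + q) = D p + D q"
    and "p \<in> carrier (poly_ring V) \<Longrightarrow> q \<in> carrier (poly_ring V) \<Longrightarrow> D (p * q) = p * D q + q * D p"
    and "p \<in> carrier (poly_ring V) \<Longrightarrow> D (Const c * p) = Const c * D p"
  using assms by (auto simp: Der_def)

lemma der_of_Der:
  assumes "\<And>v. v \<in> V \<Longrightarrow> h v \<in> carrier (poly_ring V)"
  shows "der_of V h \<in> Der V"
  unfolding Der_def der_of_def
  by (auto intro!: carrier_sum carrier_mult carrier_partial assms
      simp: carrier_add carrier_mult partial_add partial_mult partial_Const_mult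
        distrib_left sum.distrib sum_distrib_left mult_ac)

lemma Der_1:
  assumes "D \<in> Der V"
  shows "D 1 = 0"
  using DerD(3)[OF assms, of 1 1] by auto

lemma Der_Const:
  assumes "D \<in> Der V"
  shows "D (Const c) = 0"
  using DerD(4)[OF assms, of 1 c] Der_1[OF assms] by auto

text \<open>The product rule peels one variable off a monomial, so agreement on the variables
  spreads by induction on the total degree, and from monomials by linearity.\<close>

lemma Der_eqI:
  assumes D: "D \<in> Der V" "E \<in> Der V" and eq: "\<And>v. v \<in> V \<Longrightarrow> D (Var v) = E (Var v)"
    and "p \<in> carrier (poly_ring V)"
  shows "D p = E p"
proof -
  have [simp]: "D 1 = 0" "E 1 = 0"
    using D by (simp_all add: Der_1)
  have mono: "keys m \<subseteq> V \<Longrightarrow> D (single m 1) = E (single m 1)" for m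
  proof (induction "\<Sum>v\<in>keys m. lookup m v" arbitrary: m rule: less_induct)
    case less
    show ?case
    proof (cases "m = 0")
      case False
      then obtain v where v: "v \<in> keys m"
        by (metis all_not_in_conv keys_eq_empty)
      define m' where "m' = m - single v 1"
      have m: "m = single v 1 + m'"
        unfolding m'_def using v diff_add_ind[of "{v}" m] by (simp add: add.commute)
      have sub: "keys m' \<subseteq> keys m"
        using keys_diff_nat m'_def by metis
      have "(\<Sum>w\<in>keys m'. lookup m' w) = (\<Sum>w\<in>keys m. lookup m' w)"
        using sub by (intro sum.mono_neutral_left) (auto simp: in_keys_iff)
      also have "\<dots> < (\<Sum>w\<in>keys m. lookup m w)"
        using v by (intro sum_strict_mono_ex1) (auto simp: m lookup_add)
      finally have IH: "D (single m' 1) = E (single m' 1)"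
        using less sub by blast
      have carr: "Var v \<in> carrier (poly_ring V)" "single m' 1 \<in> carrier (poly_ring V)"
        using v less.prems sub by (auto intro: carrier_Var carrier_single)
      have "single m 1 = Var v * single m' (1::'b)"
        by (simp add: Var_def mult_single m)
      then show ?thesis
        using v less.prems IH DerD(3)[OF D(1) carr] DerD(3)[OF D(2) carr] eq[of v] by auto
    qed simp
  qed
  have "keys p \<subseteq> {m. keys m \<subseteq> V}"
    using assms(4) by (auto simp: carrier_poly_ring_iff)
  then show ?thesis
  proof (induction p rule: mpoly_induct)
    case zero
    show ?case
      using DerD(2)[OF D(1), of 0 0] DerD(2)[OF D(2), of 0 0] by simp
  next
    case (single m c)
    have "single m c = Const c * single m 1"
      by (simp add: Const_mult_single)
    then show ?case
      using single mono DerD(4)[OF D(1)] DerD(4)[OF D(2)] by (simp add: carrier_single)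
  next
    case (add p q)
    then have "p \<in> carrier (poly_ring V)" "q \<in> carrier (poly_ring V)"
      unfolding carrier_poly_ring_iff by blast+
    then show ?case
      using add DerD(2)[OF D(1), of p q] DerD(2)[OF D(2), of p q] by simp
  qed
qed

lemma Der_eq_der_of:
  assumes "finite V" "D \<in> Der V" "p \<in> carrier (poly_ring V)"
  shows "D p = der_of V (\<lambda>v. D (Var v)) p"
proof (rule Der_eqI[OF assms(2) _ _ assms(3)])
  show "der_of V (\<lambda>v. D (Var v)) \<in> Der V"
    by (rule der_of_Der, rule DerD(1)[OF assms(2)], rule carrier_Var)
  fix v
  assume "v \<in> V"
  have "partial w (Var v :: ('a, 'b) mpoly) = (if w = v then 1 else 0)" for w
    by (auto simp: Var_def partial_single lookup_single when_def)
  then have "(\<Sum>w\<in>V. D (Var w) * partial w (Var v)) = (\<Sum>w\<in>V. if w = v then D (Var v) else 0)"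
    by (intro sum.cong) auto
  then show "D (Var v) = der_of V (\<lambda>v. D (Var v)) (Var v)"
    using \<open>v \<in> V\<close> assms(1) by (simp add: der_of_def carrier_Var)
qed

text \<open>The form in which derivations are compared with homomorphisms one coefficient at a
  time.\<close>

lemma lookup_der_of_single:
  assumes "keys m \<subseteq> V"
  shows "lookup (der_of V h (single m 1)) n =
    (\<Sum>v\<in>V. if \<forall>w. lookup (m - single v 1) w \<le> lookup n w
       then of_nat (lookup m v) * lookup (h v) (n - (m - single v 1)) else 0)"
  using assms
  by (simp add: der_of_def carrier_single lookup_sum partial_single mult.commute[of "h _"]
      lookup_single_mult cong: if_cong)

section \<open>Rigidity in terms of representatives\<close>

text \<open>\<open>\<Phi>\<close> picks a representative in \<open>S\<close> of each value of a homomorphism \<open>I \<rightarrow> S/I\<close>.\<close>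

definition hom_rep :: "'v set \<Rightarrow> ('v, 'k::field) mpoly set \<Rightarrow> (('v, 'k) mpoly \<Rightarrow> ('v, 'k) mpoly) \<Rightarrow> bool" where
  "hom_rep V I \<Phi> \<longleftrightarrow>
     (\<forall>f\<in>I. \<Phi> f \<in> carrier (poly_ring V)) \<and>
     (\<forall>f\<in>I. \<forall>g\<in>I. \<Phi> (f + g) - (\<Phi> f + \<Phi> g) \<in> I) \<and>
     (\<forall>s\<in>carrier (poly_ring V). \<forall>f\<in>I. \<Phi> (s * f) - s * \<Phi> f \<in> I)"

lemma coset_eq: "I +>\<^bsub>poly_ring V\<^esub> f = {g. g - f \<in> I}"
  by (force simp: a_r_coset_def r_coset_def)

text \<open>The identity of the factor group is the set N of maps induced by derivations, so
  triviality means that every homomorphism lies in N; this is checked directly on cosets. Choosing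
  representatives then turns equations in S/I into memberships in I.\<close>

lemma rigid_iff_hom_rep:
  fixes V :: "'v set"
  assumes "simplicial_complex V \<Delta>"
  defines "I \<equiv> (supp_ideal V (- \<Delta>) :: ('v, 'k::field) mpoly set)"
  shows "rigid TYPE('k) V \<Delta> \<longleftrightarrow>
    (\<forall>\<Phi>. hom_rep V I \<Phi> \<longrightarrow> (\<exists>D\<in>Der V. \<forall>f\<in>I. \<Phi> f - D f \<in> I))"
proof -
  define R where "R = (poly_ring V :: ('v, 'k) mpoly ring)"
  have SR: "SR_ideal V \<Delta> = I"
    unfolding I_def using assms(1) by (rule SR_ideal_eq)
  have up: "upset_on V (- \<Delta>)"
    using assms(1) by (auto simp: upset_on_def simplicial_complex_def)
  interpret R: cring R
    unfolding R_def by (rule cring_poly_ring)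
  interpret I: ideal I R
    unfolding I_def R_def using up by (rule supp_ideal_is_ideal)
  have I_add: "a + b \<in> I" if "a \<in> I" "b \<in> I" for a b
    using that supp_ideal_add by (auto simp: I_def)
  have I_neg: "- a \<in> I" if "a \<in> I" for a
    using that supp_ideal_uminus by (auto simp: I_def)
  have I_diff: "a - b \<in> I" if "a \<in> I" "b \<in> I" for a b
    using I_add[OF that(1) I_neg[OF that(2)]] by simp
  have I_0: "0 \<in> I"
    by (simp add: I_def)
  have R_0: "0 \<in> carrier R"
    by (simp add: R_def)
  have I_carr: "a \<in> carrier R" if "a \<in> I" for a
    using that I.a_subset by blast
  have I_mult: "s * a \<in> I" if "s \<in> carrier R" "a \<in> I" for s a
    using that up supp_ideal_mult by (auto simp: I_def R_def)
  have coset: "I +>\<^bsub>R\<^esub> f = {g. g - f \<in> I}" for f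
    by (simp add: R_def coset_eq)
  have coset_cong: "I +>\<^bsub>R\<^esub> f = I +>\<^bsub>R\<^esub> g \<longleftrightarrow> f - g \<in> I" for f g
  proof
    assume "I +>\<^bsub>R\<^esub> f = I +>\<^bsub>R\<^esub> g"
    then show "f - g \<in> I"
      using I_0 coset[of f] coset[of g] by auto
  next
    assume fg: "f - g \<in> I"
    have "x - f \<in> I \<longleftrightarrow> x - g \<in> I" for x
      using I_add[OF _ fg, of "x - f"] I_diff[OF _ fg, of "x - g"] by auto
    then show "I +>\<^bsub>R\<^esub> f = I +>\<^bsub>R\<^esub> g"
      by (simp add: coset)
  qed
  have Q_add: "(I +>\<^bsub>R\<^esub> f) \<oplus>\<^bsub>R Quot I\<^esub> (I +>\<^bsub>R\<^esub> g) = I +>\<^bsub>R\<^esub> (f + g)"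
    if "f \<in> carrier R" "g \<in> carrier R" for f g
    using I.a_rcos_sum[OF that] by (simp add: FactRing_def R_def)
  have Q_mult: "(I +>\<^bsub>R\<^esub> f) \<otimes>\<^bsub>R Quot I\<^esub> (I +>\<^bsub>R\<^esub> g) = I +>\<^bsub>R\<^esub> (f * g)"
    if "f \<in> carrier R" "g \<in> carrier R" for f g
    using I.rcoset_mult_add[OF that] by (simp add: FactRing_def R_def)
  have Q_carr: "X \<in> carrier (R Quot I) \<longleftrightarrow> (\<exists>f\<in>carrier R. X = I +>\<^bsub>R\<^esub> f)" for X
    by (auto simp: FactRing_def A_RCOSETS_def' )
  have Q_in: "I +>\<^bsub>R\<^esub> f \<in> carrier (R Quot I)" if "f \<in> carrier R" for f
    using that Q_carr by blast
  define H where "H = Hom_Quot R I"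
  have H_carr: "\<phi> \<in> carrier H \<longleftrightarrow> \<phi> \<in> I \<rightarrow>\<^sub>E carrier (R Quot I) \<and>
     (\<forall>f\<in>I. \<forall>g\<in>I. \<phi> (f + g) = \<phi> f \<oplus>\<^bsub>R Quot I\<^esub> \<phi> g) \<and>
     (\<forall>s\<in>carrier R. \<forall>f\<in>I. \<phi> (s * f) = (I +>\<^bsub>R\<^esub> s) \<otimes>\<^bsub>R Quot I\<^esub> \<phi> f)" for \<phi>
    by (simp add: H_def Hom_Quot_def R_def)
  have H_add: "\<phi> \<oplus>\<^bsub>H\<^esub> \<psi> = (\<lambda>f\<in>I. \<phi> f \<oplus>\<^bsub>R Quot I\<^esub> \<psi> f)" for \<phi> \<psi>
    by (simp add: H_def Hom_Quot_def)
  define d where "d D = (\<lambda>f\<in>I. I +>\<^bsub>R\<^esub> D f)" for D :: "('v, 'k) mpoly \<Rightarrow> ('v, 'k) mpoly"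
  have d_carr: "D f \<in> carrier R" if "D \<in> Der V" "f \<in> I" for D f
    using that DerD(1)[OF that(1), of f] I_carr by (simp add: R_def)
  have d_add: "d D \<oplus>\<^bsub>H\<^esub> d E = d (\<lambda>p\<in>carrier R. D p + E p)"
    if "D \<in> Der V" "E \<in> Der V" for D E
    using that by (auto simp: H_add d_def Q_add d_carr I_carr fun_eq_iff)
  have Der_add: "(\<lambda>p\<in>carrier R. D p + E p) \<in> Der V" if "D \<in> Der V" "E \<in> Der V" for D E
    unfolding Der_def
    by (auto simp: R_def carrier_add carrier_mult DerD[OF that(1)] DerD[OF that(2)]
        that[THEN Der_Const] algebra_simps)
  have Der_diff: "(\<lambda>p\<in>carrier R. D p - E p) \<in> Der V" if "D \<in> Der V" "E \<in> Der V" for D E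
    unfolding Der_def
    by (auto simp: R_def carrier_add carrier_minus carrier_mult DerD[OF that(1)] DerD[OF that(2)]
        that[THEN Der_Const] algebra_simps)
  have Der_0: "(\<lambda>p\<in>carrier R. 0) \<in> Der V"
    unfolding Der_def by (auto simp: R_def carrier_add carrier_mult)
  define N where "N = d ` Der V"
  have "rigid TYPE('k) V \<Delta> \<longleftrightarrow> carrier (add_monoid H Mod N) = {N}"
    by (simp add: rigid_def Let_def T1_def delta_star_def[abs_def] SR H_def N_def d_def[abs_def] R_def)
  also have "\<dots> \<longleftrightarrow> carrier H \<subseteq> N"
  proof
    assume eq: "carrier (add_monoid H Mod N) = {N}"
    show "carrier H \<subseteq> N"
    proof
      fix \<phi>
      assume \<phi>: "\<phi> \<in> carrier H"
      then have "N #>\<^bsub>add_monoid H\<^esub> \<phi> = N"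
        using eq by (auto simp: carrier_FactGroup)
      \<comment> \<open>The zero derivation puts \<phi> into its own coset.\<close>
      moreover have "d (\<lambda>p\<in>carrier R. 0) \<oplus>\<^bsub>H\<^esub> \<phi> = \<phi>"
      proof
        fix f
        show "(d (\<lambda>p\<in>carrier R. 0) \<oplus>\<^bsub>H\<^esub> \<phi>) f = \<phi> f"
        proof (cases "f \<in> I")
          case True
          then obtain p where "p \<in> carrier R" "\<phi> f = I +>\<^bsub>R\<^esub> p"
            using \<phi> Q_carr by (auto simp: H_carr PiE_def Pi_def)
          then show ?thesis
            using True I_carr Q_add[of 0 p] by (simp add: H_add d_def R_0)
        next
          case False
          then have "\<phi> f = undefined"
            using \<phi> by (auto simp: H_carr PiE_def extensional_def)
          then show ?thesis
            using False by (simp add: H_add)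
        qed
      qed
      ultimately show "\<phi> \<in> N"
        using Der_0 by (force simp: r_coset_def N_def)
    qed
  next
    assume sub: "carrier H \<subseteq> N"
    have "N #>\<^bsub>add_monoid H\<^esub> \<phi> = N" if \<phi>: "\<phi> \<in> carrier H" for \<phi>
    proof -
      obtain E where E: "E \<in> Der V" "\<phi> = d E"
        using \<phi> sub by (auto simp: N_def)
      show ?thesis
      proof (intro subset_antisym subsetI)
        fix x
        assume "x \<in> N #>\<^bsub>add_monoid H\<^esub> \<phi>"
        then obtain D where "D \<in> Der V" "x = d D \<oplus>\<^bsub>H\<^esub> d E"
          using E by (auto simp: r_coset_def N_def)
        then show "x \<in> N"
          using E Der_add d_add by (auto simp: N_def)
      next
        fix x
        assume "x \<in> N"
        then obtain D where D: "D \<in> Der V" "x = d D"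
          by (auto simp: N_def)
        have "x = d (\<lambda>p\<in>carrier R. D p - E p) \<oplus>\<^bsub>H\<^esub> d E"
          unfolding d_add[OF Der_diff[OF D(1) E(1)] E(1)] D(2) by (auto simp: d_def fun_eq_iff I_carr)
        then show "x \<in> N #>\<^bsub>add_monoid H\<^esub> \<phi>"
          using Der_diff[OF D(1) E(1)] E(2) by (auto simp: r_coset_def N_def)
      qed
    qed
    \<comment> \<open>The factor group must have an element for its carrier to be {N}; the zero
      homomorphism supplies one.\<close>
    moreover have "(\<lambda>f\<in>I. I +>\<^bsub>R\<^esub> 0) \<in> carrier H"
    proof -
      have "f + g \<in> I" "s * f \<in> I" if "f \<in> I" "g \<in> I" "s \<in> carrier R" for f g s
        using that I_add I_mult by auto
      then show ?thesis
        using R_0 by (auto simp: H_carr Q_add Q_mult Q_carr)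
    qed
    ultimately show "carrier (add_monoid H Mod N) = {N}"
      by (auto simp: carrier_FactGroup)
  qed
  also have "\<dots> \<longleftrightarrow> (\<forall>\<Phi>. hom_rep V I \<Phi> \<longrightarrow> (\<exists>D\<in>Der V. \<forall>f\<in>I. \<Phi> f - D f \<in> I))"
  proof
    assume sub: "carrier H \<subseteq> N"
    show "\<forall>\<Phi>. hom_rep V I \<Phi> \<longrightarrow> (\<exists>D\<in>Der V. \<forall>f\<in>I. \<Phi> f - D f \<in> I)"
    proof (intro allI impI)
      fix \<Phi>
      assume \<Phi>: "hom_rep V I \<Phi>"
      have "(\<lambda>f\<in>I. I +>\<^bsub>R\<^esub> \<Phi> f) \<in> carrier H"
        using \<Phi> I_add I_mult
        by (auto simp: H_carr Q_in hom_rep_def Q_add Q_mult coset_cong R_def[symmetric])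
      then obtain D where D: "D \<in> Der V" and eq: "(\<lambda>f\<in>I. I +>\<^bsub>R\<^esub> \<Phi> f) = d D"
        using sub by (auto simp: N_def)
      have "\<Phi> f - D f \<in> I" if "f \<in> I" for f
        using fun_cong[OF eq, of f] that by (simp add: d_def coset_cong)
      with D show "\<exists>D\<in>Der V. \<forall>f\<in>I. \<Phi> f - D f \<in> I"
        by blast
    qed
  next
    assume hyp: "\<forall>\<Phi>. hom_rep V I \<Phi> \<longrightarrow> (\<exists>D\<in>Der V. \<forall>f\<in>I. \<Phi> f - D f \<in> I)"
    show "carrier H \<subseteq> N"
    proof
      fix \<phi>
      assume \<phi>: "\<phi> \<in> carrier H"
      then have "\<forall>f\<in>I. \<exists>p\<in>carrier R. \<phi> f = I +>\<^bsub>R\<^esub> p"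
        using Q_carr by (auto simp: H_carr PiE_def Pi_def)
      then obtain \<Phi> where \<Phi>: "\<And>f. f \<in> I \<Longrightarrow> \<Phi> f \<in> carrier R" "\<And>f. f \<in> I \<Longrightarrow> \<phi> f = I +>\<^bsub>R\<^esub> \<Phi> f"
        by metis
      have "\<Phi> (f + g) - (\<Phi> f + \<Phi> g) \<in> I" if "f \<in> I" "g \<in> I" for f g
        using \<phi> that \<Phi>(2)[OF I_add[OF that]] by (simp add: H_carr \<Phi> Q_add flip: coset_cong)
      moreover have "\<Phi> (s * f) - s * \<Phi> f \<in> I" if "s \<in> carrier R" "f \<in> I" for s f
        using \<phi> that \<Phi>(2)[OF I_mult[OF that]] by (simp add: H_carr \<Phi> Q_mult flip: coset_cong)
      ultimately have "hom_rep V I \<Phi>"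
        using \<Phi>(1) by (simp add: hom_rep_def R_def)
      then obtain D where D: "D \<in> Der V" "\<And>f. f \<in> I \<Longrightarrow> \<Phi> f - D f \<in> I"
        using hyp by blast
      have "\<phi> f = d D f" for f
      proof (cases "f \<in> I")
        case True
        then show ?thesis
          using D(2) \<Phi>(2) coset_cong by (simp add: d_def)
      next
        case False
        then show ?thesis
          using \<phi> by (simp add: H_carr PiE_def extensional_def d_def)
      qed
      with D(1) show "\<phi> \<in> N"
        unfolding N_def by blast
    qed
  qed
  finally show ?thesis .
qed

section \<open>Rigidity in terms of supports\<close>

text \<open>A homomorphism \<open>I \<rightarrow> S/I\<close> homogeneous of degree \<open>a - b\<close>, where \<open>a\<close> and \<open>b\<close> have disjoint
  supports \<open>A\<close> and \<open>B\<close>, is given by the coefficients \<open>l\<close> of \<open>x\<^sup>n\<^sup>+\<^sup>a\<close> in the image of \<open>x\<^sup>n\<^sup>+\<^sup>b\<close>.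
  It vanishes unless \<open>b\<close> is squarefree, and then \<open>l\<close> depends only on the support of \<open>n\<close>.
  Derivations contribute exactly the constant functions \<open>l\<close> with \<open>card B = 1\<close>.\<close>

definition hom_dom :: "'v set \<Rightarrow> 'v set set \<Rightarrow> 'v set \<Rightarrow> 'v set \<Rightarrow> 'v set set" where
  "hom_dom V \<Delta> A B = {F. F \<subseteq> V \<and> F \<union> A \<in> \<Delta> \<and> F \<union> B \<notin> \<Delta>}"

text \<open>Both conditions express compatibility with multiplication by x_v. In the first, x_v
  multiplies argument and value alike. In the second, x^F x^(B - {v}) already lies in I, so modulo I
  the image of x^F x^B is a multiple of x_v; its coefficient at x^F x^A vanishes because v lies
  neither in F nor, A and B being disjoint, in A.\<close>

definition graded_hom ::
    "'v set \<Rightarrow> 'v set set \<Rightarrow> 'v set \<Rightarrow> 'v set \<Rightarrow> ('v set \<Rightarrow> 'k::zero) \<Rightarrow> bool" where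
  "graded_hom V \<Delta> A B l \<longleftrightarrow>
     (\<forall>F v. F \<in> hom_dom V \<Delta> A B \<longrightarrow> insert v F \<in> hom_dom V \<Delta> A B \<longrightarrow> l (insert v F) = l F) \<and>
     (\<forall>F v. F \<in> hom_dom V \<Delta> A B \<longrightarrow> v \<in> B - F \<longrightarrow> F \<union> (B - {v}) \<notin> \<Delta> \<longrightarrow> l F = 0)"

text \<open>The case B = {} is left out because there F \<union> A \<in> \<Delta> forces F \<in>
  \<Delta>, so that the domain is empty.\<close>

definition comb_rigid :: "'k::zero itself \<Rightarrow> 'v set \<Rightarrow> 'v set set \<Rightarrow> bool" where
  "comb_rigid K V \<Delta> \<longleftrightarrow>
     (\<forall>A B (l :: 'v set \<Rightarrow> 'k). A \<subseteq> V \<longrightarrow> B \<subseteq> V \<longrightarrow> A \<inter> B = {} \<longrightarrow> B \<noteq> {} \<longrightarrow> graded_hom V \<Delta> A B l \<longrightarrow>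
       (if is_singleton B then \<forall>F\<in>hom_dom V \<Delta> A B. \<forall>G\<in>hom_dom V \<Delta> A B. l F = l G
        else \<forall>F\<in>hom_dom V \<Delta> A B. l F = 0))"

lemma comb_rigid_singletonD:
  fixes l :: "'v set \<Rightarrow> 'k::zero"
  assumes "comb_rigid TYPE('k) V \<Delta>" "A \<subseteq> V" "v \<in> V" "v \<notin> A" "graded_hom V \<Delta> A {v} l"
    and "F \<in> hom_dom V \<Delta> A {v}" "G \<in> hom_dom V \<Delta> A {v}"
  shows "l F = l G"
proof -
  have s: "is_singleton {v}"
    by simp
  have "A \<inter> {v} = {}" "{v} \<subseteq> V" "{v} \<noteq> {}"
    using assms by auto
  then show ?thesis
    using assms(1)[unfolded comb_rigid_def, THEN spec[of _ A], THEN spec[of _ "{v}"], THEN spec[of _ l]] assms(2-)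
    unfolding if_P[OF s] by blast
qed

lemma comb_rigid_zeroD:
  fixes l :: "'v set \<Rightarrow> 'k::zero"
  assumes "comb_rigid TYPE('k) V \<Delta>" "A \<subseteq> V" "B \<subseteq> V" "A \<inter> B = {}" "B \<noteq> {}" "\<not> is_singleton B"
    and "graded_hom V \<Delta> A B l" "F \<in> hom_dom V \<Delta> A B"
  shows "l F = 0"
  using assms(1)[unfolded comb_rigid_def, THEN spec[of _ A], THEN spec[of _ B], THEN spec[of _ l]] assms(2-)
  unfolding if_not_P[OF assms(6)] by blast

lemma simplicial_complexD:
  assumes "simplicial_complex V \<Delta>"
  shows "finite V" "F \<in> \<Delta> \<Longrightarrow> F \<subseteq> V" "F \<in> \<Delta> \<Longrightarrow> G \<subseteq> F \<Longrightarrow> G \<in> \<Delta>" "{} \<in> \<Delta>" "F \<subseteq> V \<Longrightarrow> finite F"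
  using assms finite_subset by (auto simp: simplicial_complex_def)

lemma keys_mono_nat:
  fixes m n :: "'v \<Rightarrow>\<^sub>0 nat"
  assumes "\<And>v. lookup m v \<le> lookup n v"
  shows "keys m \<subseteq> keys n"
proof
  fix v
  assume "v \<in> keys m"
  then show "v \<in> keys n"
    using assms[of v] by (simp add: in_keys_iff)
qed

text \<open>Enlarge F to G one vertex at a time: the condition on A passes to subsets of G and the
  condition on B to supersets of F, so every intermediate set stays in the domain.\<close>

lemma graded_hom_mono:
  assumes sc: "simplicial_complex V \<Delta>" and l: "graded_hom V \<Delta> A B l"
    and F: "F \<in> hom_dom V \<Delta> A B" and G: "G \<in> hom_dom V \<Delta> A B" and "F \<subseteq> G"
  shows "l F = l G"
proof -
  have "finite S \<Longrightarrow> S \<subseteq> G \<Longrightarrow> F \<union> S \<in> hom_dom V \<Delta> A B \<and> l (F \<union> S) = l F" for S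
  proof (induction S rule: finite_induct)
    case (insert v S)
    have "insert v (F \<union> S) \<in> hom_dom V \<Delta> A B"
      unfolding hom_dom_def
    proof (intro CollectI conjI)
      show "insert v (F \<union> S) \<subseteq> V"
        using insert.prems \<open>F \<subseteq> G\<close> G by (auto simp: hom_dom_def)
      show "insert v (F \<union> S) \<union> A \<in> \<Delta>"
        by (rule simplicial_complexD(3)[OF sc, of "G \<union> A"])
          (use insert.prems \<open>F \<subseteq> G\<close> G in \<open>auto simp: hom_dom_def\<close>)
      show "insert v (F \<union> S) \<union> B \<notin> \<Delta>"
        using F simplicial_complexD(3)[OF sc, of "insert v (F \<union> S) \<union> B" "F \<union> B"]
        by (auto simp: hom_dom_def)
    qed
    then show ?case
      using insert l by (auto simp: graded_hom_def)
  qed (use F in auto)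
  from this[of G] show ?thesis
    using simplicial_complexD(5)[OF sc] G \<open>F \<subseteq> G\<close> by (auto simp: hom_dom_def Un_absorb1)
qed

text \<open>Modulo I, \<Phi> is determined by the coefficients c m n of x^n in \<Phi>(x^m) with x^m
  in I and n supported on a face. Combinatorial rigidity makes them 0 unless n - m = a - e_u, and
  then dependent only on u and a. These values are the coefficients of the polynomials h_u of the
  derivation.\<close>

lemma comb_rigid_imp_hom_rep_trivial:
  fixes V :: "'v set" and \<Phi> :: "('v, 'k::field) mpoly \<Rightarrow> ('v, 'k) mpoly"
  assumes sc: "simplicial_complex V \<Delta>"
  defines "I \<equiv> (supp_ideal V (- \<Delta>) :: ('v, 'k::field) mpoly set)"
  assumes cr: "comb_rigid TYPE('k) V \<Delta>" and \<Phi>: "hom_rep V I \<Phi>"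
  shows "\<exists>D\<in>Der V. \<forall>f\<in>I. \<Phi> f - D f \<in> I"
proof -
  note fin = simplicial_complexD(1)[OF sc] simplicial_complexD(5)[OF sc]
  note face = simplicial_complexD(2,3)[OF sc]
  have up: "upset_on V (- \<Delta>)"
    using face by (auto simp: upset_on_def)
  have I_lookup: "lookup p n = 0" if "p \<in> I" "keys n \<in> \<Delta>" for p n
    using that by (auto simp: I_def supp_ideal_def in_keys_iff)
  define c where "c m n = lookup (\<Phi> (single m 1)) n" for m n
  \<comment> \<open>Compare coefficients in \<Phi>(x^e x^m) = x^e \<Phi>(x^m), which holds modulo I;
    elements of I have coefficient 0 at exponents supported on faces.\<close>
  have c_add: "c (e + m) n = (if \<forall>v. lookup e v \<le> lookup n v then c m (n - e) else 0)"
    if "keys m \<subseteq> V" "keys m \<notin> \<Delta>" "keys e \<subseteq> V" "keys n \<in> \<Delta>" for m e n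
  proof -
    have "single m 1 \<in> I" "single e 1 \<in> carrier (poly_ring V)"
      using that by (auto simp: I_def intro: supp_ideal_single carrier_single)
    then have "\<Phi> (single e 1 * single m 1) - single e 1 * \<Phi> (single m 1) \<in> I"
      using \<Phi> by (auto simp: hom_rep_def)
    from I_lookup[OF this that(4)] show ?thesis
      by (simp add: lookup_minus mult_single lookup_single_mult c_def)
  qed
  have c_shift: "c (e + m) (e + n) = c m n"
    if "keys m \<subseteq> V" "keys m \<notin> \<Delta>" "keys (e + n) \<in> \<Delta>" for m e n
    using c_add[of m e "e + n"] that face(1)[OF that(3)] by (auto simp: lookup_add)
  have gh: "graded_hom V \<Delta> (keys a) B (\<lambda>F. c (ind F + ind B) (ind F + a))"
    if a: "keys a \<subseteq> V" and B: "B \<subseteq> V" "keys a \<inter> B = {}" for a B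
    unfolding graded_hom_def
  proof (intro conjI allI impI)
    fix F v
    assume F: "F \<in> hom_dom V \<Delta> (keys a) B" and vF: "insert v F \<in> hom_dom V \<Delta> (keys a) B"
    show "c (ind (insert v F) + ind B) (ind (insert v F) + a) = c (ind F + ind B) (ind F + a)"
    proof (cases "v \<in> F")
      case False
      then have "ind (insert v F) = single v 1 + ind F"
        using F fin by (auto simp: ind_def hom_dom_def)
      then show ?thesis
        using c_shift[of "ind F + ind B" "single v 1" "ind F + a"] F vF fin B
        by (auto simp: hom_dom_def add.assoc)
    qed (simp add: insert_absorb)
  next
    fix F v
    assume F: "F \<in> hom_dom V \<Delta> (keys a) B" and v: "v \<in> B - F" and nf: "F \<union> (B - {v}) \<notin> \<Delta>"
    have finite: "finite F" "finite B"
      using F B fin by (auto simp: hom_dom_def)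
    then have B_eq: "ind F + ind B = single v 1 + (ind F + ind (B - {v}))"
      using v sum.remove[of B v "\<lambda>v. single v (1::nat)"] by (simp add: ind_def ac_simps)
    have "lookup (ind F + a) v = 0"
      using finite v B by (auto simp: lookup_add lookup_ind in_keys_iff)
    then have ne: "\<not> (\<forall>w. lookup (single v 1) w \<le> lookup (ind F + a) w)"
      by (metis lookup_single_eq not_one_le_zero)
    have "keys (ind F + ind (B - {v})) \<subseteq> V" "keys (ind F + ind (B - {v})) \<notin> \<Delta>"
      "keys (single v 1) \<subseteq> V" "keys (ind F + a) \<in> \<Delta>"
      using nf F finite B v by (auto simp: hom_dom_def)
    from c_add[OF this] show "c (ind F + ind B) (ind F + a) = 0"
      unfolding B_eq if_not_P[OF ne] .
  qed
  \<comment> \<open>Dividing x^m by x_v^(n_v + 1) leaves at least one factor x_v, so the quotient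
    has the same support and still lies in I. Modulo I the image is therefore divisible by x_v^(n_v
    + 1), which x^n is not. This is why only squarefree b survive.\<close>
  have c_high: "c m n = 0"
    if m: "keys m \<subseteq> V" "keys m \<notin> \<Delta>" and n: "keys n \<in> \<Delta>" and v: "lookup m v \<ge> lookup n v + 2" for m n v
  proof -
    define e where "e = single v (lookup n v + 1)"
    have m_eq: "m = e + (m - e)"
      using v by (intro poly_mapping_eqI) (auto simp: e_def lookup_add lookup_minus lookup_single when_def)
    have "keys (m - e) = keys m"
      using v by (auto simp: e_def in_keys_iff lookup_minus lookup_single when_def)
    moreover have "keys e \<subseteq> V"
      using m v by (auto simp: e_def in_keys_iff lookup_single when_def)
    moreover have "\<not> (\<forall>w. lookup e w \<le> lookup n w)"
      by (auto simp: e_def intro!: exI[of _ v])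
    ultimately show ?thesis
      using c_add[of "m - e" e n] m n unfolding m_eq[symmetric] by presburger
  qed
  \<comment> \<open>Cancelling the repeated factors of x^n' leads to the squarefree representative
    with F the support of n'.\<close>
  have c_supp: "F \<in> hom_dom V \<Delta> (keys a) B \<and> c m n = c (ind F + ind B) (ind F + a)"
    if m: "keys m \<subseteq> V" "keys m \<notin> \<Delta>" and n: "keys n \<in> \<Delta>" and B: "B \<subseteq> V"
      and eq: "m = n' + ind B" "n = n' + a" "F = keys n'" for m n n' a B F
  proof -
    have fB: "finite B" and fF: "finite F"
      using B fin eq by auto
    have n': "n' = (n' - ind F) + ind F"
      using fF eq by (simp add: diff_add_ind)
    show ?thesis
      using c_shift[of "ind F + ind B" "n' - ind F" "ind F + a"] m n eq fB fF n' keys_diff_nat[of n' "ind F"]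
      by (auto simp: hom_dom_def Un_absorb1 simp flip: add.assoc)
  qed
  have rigid1: "c (ind F + single v 1) (ind F + a) = c (ind G + single v 1) (ind G + a)"
    if "keys a \<subseteq> V" "v \<in> V - keys a"
      "F \<in> hom_dom V \<Delta> (keys a) {v}" "G \<in> hom_dom V \<Delta> (keys a) {v}" for a v F G
    using comb_rigid_singletonD[OF cr that(1) _ _ gh[of a "{v}"] that(3,4)] that(1,2) by simp
  have rigid2: "c (ind F + ind B) (ind F + a) = 0"
    if "keys a \<subseteq> V" "B \<subseteq> V" "keys a \<inter> B = {}" "B \<noteq> {}" "\<not> is_singleton B"
      "F \<in> hom_dom V \<Delta> (keys a) B" for a B F
    using comb_rigid_zeroD[OF cr that(1-5) gh[OF that(1-3)] that(6)] .
  \<comment> \<open>The value common to all sets of the domain, taken at an arbitrary one. With the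
    default 0 for an empty domain, every nonzero value is an actual coefficient of some \<Phi>(x^G
    x_v).\<close>
  define \<kappa> where "\<kappa> v a = (if keys a \<subseteq> V \<and> v \<notin> keys a \<and> hom_dom V \<Delta> (keys a) {v} \<noteq> {}
      then let G = (SOME G. G \<in> hom_dom V \<Delta> (keys a) {v}) in c (ind G + single v 1) (ind G + a)
      else 0)" for v a
  have \<kappa>_eq: "\<kappa> v a = c (ind F + single v 1) (ind F + a)"
    if "keys a \<subseteq> V" "v \<in> V - keys a" "F \<in> hom_dom V \<Delta> (keys a) {v}" for v a F
  proof -
    have "(SOME G. G \<in> hom_dom V \<Delta> (keys a) {v}) \<in> hom_dom V \<Delta> (keys a) {v}"
      using that(3) by (rule someI)
    from rigid1[OF that(1,2) this that(3)] show ?thesis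
      using that by (auto simp: \<kappa>_def Let_def)
  qed
  have \<kappa>_nz: "\<exists>G\<subseteq>V. a \<in> (\<lambda>n. n - ind G) ` keys (\<Phi> (single (ind G + single v 1) 1))"
    if "\<kappa> v a \<noteq> 0" for v a
  proof -
    from that obtain G where G: "G \<in> hom_dom V \<Delta> (keys a) {v}" "c (ind G + single v 1) (ind G + a) \<noteq> 0"
      unfolding \<kappa>_def Let_def by (metis equals0I some_in_eq)
    have "a = (ind G + a) - ind G"
      by simp
    then show ?thesis
      using G by (intro exI[of _ G]) (auto simp: c_def in_keys_iff hom_dom_def intro!: image_eqI[where x = "ind G + a"])
  qed
  \<comment> \<open>This makes h_v a polynomial: its exponents come from the finitely many
    polynomials \<Phi>(x^G x_v) with G \<subseteq> V.\<close>
  have "finite {a. \<kappa> v a \<noteq> 0}" for v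
  proof (rule finite_subset)
    show "{a. \<kappa> v a \<noteq> 0} \<subseteq> (\<Union>G\<in>Pow V. (\<lambda>n. n - ind G) ` keys (\<Phi> (single (ind G + single v 1) 1)))"
    proof
      fix a
      assume "a \<in> {a. \<kappa> v a \<noteq> 0}"
      then obtain G where "G \<subseteq> V" "a \<in> (\<lambda>n. n - ind G) ` keys (\<Phi> (single (ind G + single v 1) 1))"
        using \<kappa>_nz[of v a] by auto
      then show "a \<in> (\<Union>G\<in>Pow V. (\<lambda>n. n - ind G) ` keys (\<Phi> (single (ind G + single v 1) 1)))"
        by (intro UN_I[of G]) simp_all
    qed
    show "finite (\<Union>G\<in>Pow V. (\<lambda>n. n - ind G) ` keys (\<Phi> (single (ind G + single v 1) 1)))"
      using fin(1) by simp
  qed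
  then have Abs: "lookup (Abs_poly_mapping (\<kappa> v)) = \<kappa> v" for v
    by simp
  define h where "h v = Abs_poly_mapping (\<kappa> v)" for v
  have lookup_h: "lookup (h v) = \<kappa> v" for v
    unfolding h_def by (rule Abs)
  have "keys a \<subseteq> V" if "a \<in> keys (h v)" for a v
  proof -
    have "\<kappa> v a \<noteq> 0"
      using that lookup_h[of v] by (simp add: in_keys_iff[of a])
    then show ?thesis
      by (simp add: \<kappa>_def split: if_splits)
  qed
  then have "h v \<in> carrier (poly_ring V)" for v
    by (simp add: carrier_poly_ring_iff)
  then have D: "der_of V h \<in> Der V"
    by (rule der_of_Der)
  have main: "c m n = lookup (der_of V h (single m 1)) n"
    if m: "keys m \<subseteq> V" "keys m \<notin> \<Delta>" and n: "keys n \<in> \<Delta>" for m n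
  proof -
    note sum_eq = lookup_der_of_single[OF m(1), of h n, unfolded lookup_h]
    have nle: "\<exists>v. lookup m v > lookup n v"
    proof (rule ccontr)
      assume "\<not> (\<exists>v. lookup m v > lookup n v)"
      then have "keys m \<subseteq> keys n"
        by (intro keys_mono_nat) (simp add: not_less)
      then show False
        using m n face by blast
    qed
    show ?thesis
    proof (cases "\<exists>u. m - n = single u 1")
      case True
      then obtain u where u: "m - n = single u 1"
        by blast
      have mn: "lookup m w - lookup n w = (if w = u then 1 else 0)" for w
        using arg_cong[OF u, of "\<lambda>p. lookup p w"] by (auto simp: lookup_minus lookup_single when_def)
      have mu: "lookup m u = Suc (lookup n u)" and mw: "w \<noteq> u \<Longrightarrow> lookup m w \<le> lookup n w" for w
        using mn[of u] mn[of w] by auto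
      \<comment> \<open>If u occurred in n, the whole support of m would lie in the face formed by
        the support of n. Hence x_u occurs in x^m exactly once, and its derivative brings in the
        factor 1 in any characteristic.\<close>
      have "lookup n u = 0"
      proof (rule ccontr)
        assume "lookup n u \<noteq> 0"
        then have "w \<in> keys n" if "w \<in> keys m" for w
          using that mw[of w] by (cases "w = u") (auto simp: in_keys_iff)
        then have "keys m \<subseteq> keys n"
          by blast
        then show False
          using m n face by blast
      qed
      then have mu1: "lookup m u = 1" and nu: "u \<notin> keys n"
        using mu by (auto simp: in_keys_iff)
      have uV: "u \<in> V"
        using mu1 m by (auto simp: in_keys_iff)
      \<comment> \<open>x^n' is the gcd of x^m and x^n; cancelling it leaves the disjoint exponents
        e_u and a.\<close>
      define n' where "n' = m - single u 1"
      define a where "a = n - n'"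
      have m_eq: "m = n' + ind {u}"
        using mu1 diff_add_ind[of "{u}" m] by (simp add: n'_def in_keys_iff)
      have le: "lookup n' w \<le> lookup n w" for w
        using mu mw[of w] by (auto simp: n'_def lookup_minus lookup_single when_def)
      then have n_eq: "n = n' + a"
        unfolding a_def by (intro poly_mapping_eqI) (auto simp: lookup_add lookup_minus)
      have a: "keys a \<subseteq> V" "u \<in> V - keys a"
        using n face(1)[OF n] nu uV by (auto simp: n_eq)
      have "(\<Sum>v\<in>V. if \<forall>w. lookup (m - single v 1) w \<le> lookup n w
            then of_nat (lookup m v) * \<kappa> v (n - (m - single v 1)) else 0)
          = (\<Sum>v\<in>V. if v = u then \<kappa> u a else 0)"
      proof (intro sum.cong refl)
        fix v
        assume "v \<in> V"
        have "\<not> (\<forall>w. lookup (m - single v 1) w \<le> lookup n w)" if "v \<noteq> u"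
          using that mu by (auto simp: lookup_minus lookup_single when_def intro!: exI[of _ u])
        then show "(if \<forall>w. lookup (m - single v 1) w \<le> lookup n w
            then of_nat (lookup m v) * \<kappa> v (n - (m - single v 1)) else 0) = (if v = u then \<kappa> u a else 0)"
          using le mu1 by (auto simp: a_def n'_def)
      qed
      also have "\<dots> = \<kappa> u a"
        using uV fin(1) by simp
      also have "\<dots> = c m n"
        using c_supp[OF m n _ m_eq n_eq refl] uV \<kappa>_eq[OF a, of "keys n'"] by auto
      finally show ?thesis
        using sum_eq by simp
    next
      case False
      \<comment> \<open>If the summand of v reached x^n, the only variable in which m exceeds n
        would be x_v, by exactly one, so m - n would be e_v.\<close>
      have "(if \<forall>w. lookup (m - single v 1) w \<le> lookup n w
          then of_nat (lookup m v) * \<kappa> v (n - (m - single v 1)) else 0) = 0" for v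
      proof (rule ccontr)
        assume "\<not> ?thesis"
        then have le: "\<And>w. lookup (m - single v 1) w \<le> lookup n w"
          by (auto split: if_splits)
        obtain w where w: "lookup m w > lookup n w"
          using nle by blast
        have "w = v"
          using w le[of w] by (auto simp: lookup_minus lookup_single when_def split: if_splits)
        have "lookup (m - n) x = lookup (single v 1) x" for x
          using w \<open>w = v\<close> le[of x] by (auto simp: lookup_minus lookup_single when_def)
        then have "m - n = single v 1"
          by (rule poly_mapping_eqI)
        then show False
          using False by blast
      qed
      then have "lookup (der_of V h (single m 1)) n = 0"
        using sum_eq by simp
      moreover have "c m n = 0"
      proof (cases "\<exists>v. lookup m v \<ge> lookup n v + 2")
        case True
        then show ?thesis
          using c_high m n by blast
      next
        case no2: False
        define B where "B = keys (m - n)"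
        obtain v where "lookup n v < lookup m v"
          using nle by blast
        then have "v \<in> B"
          by (simp add: B_def in_keys_iff lookup_minus)
        then have B: "B \<subseteq> V" "B \<noteq> {}"
          using m(1) keys_diff_nat[of m n] by (auto simp: B_def)
        have fB: "finite B"
          using B fin by blast
        have b: "m - n = ind B"
        proof (rule poly_mapping_eqI)
          fix w
          have "lookup m w < lookup n w + 2"
            using no2 by (meson not_less)
          then show "lookup (m - n) w = lookup (ind B) w"
            using fB by (auto simp: lookup_ind B_def in_keys_iff lookup_minus)
        qed
        define n' where "n' = m - ind B"
        define a where "a = n - m"
        have m_eq: "m = n' + ind B"
          using diff_add_ind[OF fB, of m] keys_diff_nat[of m n] by (simp add: n'_def B_def)
        have n_eq: "n = n' + a"
          unfolding n'_def a_def b[symmetric]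
          by (intro poly_mapping_eqI) (auto simp: lookup_add lookup_minus)
        have "\<not> is_singleton B"
          using False b by (auto simp: is_singleton_def)
        moreover have "keys a \<subseteq> V" "keys a \<inter> B = {}"
          using face(1)[OF n] by (auto simp: a_def B_def in_keys_iff lookup_minus)
        ultimately show ?thesis
          using c_supp[OF m n B(1) m_eq n_eq refl] rigid2 B by simp
      qed
      ultimately show ?thesis
        by simp
    qed
  qed
  have "\<Phi> f - der_of V h f \<in> I" if "f \<in> I" for f
  proof -
    have sub: "p \<in> I \<longleftrightarrow> keys p \<subseteq> {m. keys m \<subseteq> V \<and> keys m \<in> - \<Delta>}" for p
      by (auto simp: I_def supp_ideal_def)
    have I_add: "p + q \<in> I" if "p \<in> I" "q \<in> I" for p q
      using that by (auto simp: I_def supp_ideal_add)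
    from that[unfolded sub] show ?thesis
    proof (induction f rule: mpoly_induct)
      case zero
      have "0 \<in> I"
        by (simp add: I_def)
      \<comment> \<open>\<Phi> is only a choice of representatives, so \<Phi> 0 need not be 0;
        writing 0 as 0 * 0 shows that it lies in I.\<close>
      then have "\<Phi> (0 * 0) - 0 * \<Phi> 0 \<in> I"
        using \<Phi> carrier_0 unfolding hom_rep_def by blast
      then show ?case
        using Der_Const[OF D, of 0] by simp
    next
      case (single m d)
      then have m: "keys m \<subseteq> V" "keys m \<notin> \<Delta>" and mI: "single m 1 \<in> I"
        by (auto simp: sub)
      have "\<Phi> (single m 1) - der_of V h (single m 1) \<in> carrier (poly_ring V)"
        using \<Phi> mI m by (intro carrier_minus DerD(1)[OF D]) (auto simp: hom_rep_def carrier_single)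
      moreover have "lookup (\<Phi> (single m 1) - der_of V h (single m 1)) n = 0" if "keys n \<in> \<Delta>" for n
        using main[OF m that] by (simp add: lookup_minus c_def)
      ultimately have 1: "\<Phi> (single m 1) - der_of V h (single m 1) \<in> I"
        by (auto simp: I_def supp_ideal_def carrier_poly_ring_iff in_keys_iff)
      have "\<Phi> (Const d * single m 1) - Const d * \<Phi> (single m 1) \<in> I"
        using \<Phi> mI by (auto simp: hom_rep_def)
      moreover have "Const d * (\<Phi> (single m 1) - der_of V h (single m 1)) \<in> I"
        using 1 supp_ideal_mult[OF up carrier_Const] unfolding I_def by blast
      ultimately have "\<Phi> (Const d * single m 1) - Const d * \<Phi> (single m 1) +
          Const d * (\<Phi> (single m 1) - der_of V h (single m 1)) \<in> I"
        by (rule I_add)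
      moreover have "der_of V h (Const d * single m 1) = Const d * der_of V h (single m 1)"
        using m by (intro DerD(4)[OF D]) (simp add: carrier_single)
      ultimately show ?case
        by (simp add: Const_mult_single algebra_simps)
    next
      case (add p q)
      then have "p \<in> I" "q \<in> I"
        by (auto simp: sub)
      then have sum: "\<Phi> (p + q) - (\<Phi> p + \<Phi> q) \<in> I" "der_of V h (p + q) = der_of V h p + der_of V h q"
        using \<Phi> by (auto simp: hom_rep_def I_def intro!: DerD(2)[OF D] supp_ideal_carrier)
      show ?case
        using I_add[OF I_add[OF add.IH] sum(1)] sum(2) by (simp add: algebra_simps)
    qed
  qed
  then show ?thesis
    using D by blast
qed

text \<open>Read l as the map sending x^m to l(supp(m - b)) x^(m - b + a), and compare it with the
  derivation that has coefficients h_v, at x^F x^A in the image of x^F x^B. If B has at least two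
  elements, no summand of the derivation reaches that monomial; if B = {u}, only h_u does, through
  its coefficient at x^A, which does not involve F.\<close>

lemma hom_rep_trivial_imp_comb_rigid:
  fixes V :: "'v set" 
  assumes sc: "simplicial_complex V \<Delta>"
  defines "I \<equiv> (supp_ideal V (- \<Delta>) :: ('v, 'k::field) mpoly set)"
  assumes triv: "\<And>\<Phi>. hom_rep V I \<Phi> \<Longrightarrow> \<exists>D\<in>Der V. \<forall>f\<in>I. \<Phi> f - D f \<in> I"
  shows "comb_rigid TYPE('k) V \<Delta>"
  unfolding comb_rigid_def
proof (intro allI impI)
  fix A B and l :: "'v set \<Rightarrow> 'k"
  assume A: "A \<subseteq> V" and B: "B \<subseteq> V" "A \<inter> B = {}" "B \<noteq> {}" and l: "graded_hom V \<Delta> A B l"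
  note fin = simplicial_complexD(1)[OF sc] simplicial_complexD(5)[OF sc]
  note face = simplicial_complexD(2,3)[OF sc]
  have fA: "finite A" and fB: "finite B"
    using A B fin by auto
  have up: "upset_on V (- \<Delta>)"
    using face by (auto simp: upset_on_def)
  have sub: "p \<in> I \<longleftrightarrow> keys p \<subseteq> {m. keys m \<subseteq> V \<and> keys m \<in> - \<Delta>}" for p
    by (auto simp: I_def supp_ideal_def)
  have I_add: "p + q \<in> I" if "p \<in> I" "q \<in> I" for p q
    using that by (auto simp: I_def supp_ideal_add)
  have I_lookup: "lookup p n = 0" if "p \<in> I" "keys n \<in> \<Delta>" for p n
    using that by (auto simp: I_def supp_ideal_def in_keys_iff)
  \<comment> \<open>For x^m in I this says that x^B divides x^m and that the target monomial lies
    outside I; sending m to 0 when the target lies in I changes nothing in S/I.\<close>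
  define P where "P m \<longleftrightarrow> (\<forall>v\<in>B. lookup m v \<noteq> 0) \<and> keys (m - ind B) \<in> hom_dom V \<Delta> A B" for m
  define T where "T m = (if P m then single (m - ind B + ind A) (l (keys (m - ind B))) else 0)" for m
  define \<Phi> where "\<Phi> = linext T"
  have P_keys: "keys m = keys (m - ind B) \<union> B" if "\<forall>v\<in>B. lookup m v \<noteq> 0" for m
    using that fB by (auto simp: in_keys_iff lookup_minus lookup_ind)
  have T_step: "T (e + m) - single e 1 * T m \<in> I"
    if e: "keys e \<subseteq> V" and m: "keys m \<subseteq> V" "keys m \<notin> \<Delta>" for e m
  proof (cases "\<forall>v\<in>B. lookup m v \<noteq> 0")
    case True
    define F where "F = keys (m - ind B)"
    have km: "keys m = F \<union> B"
      unfolding F_def by (rule P_keys) fact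
    have shift: "e + m - ind B = e + (m - ind B)"
      using True fB by (intro poly_mapping_eqI) (auto simp: lookup_add lookup_minus lookup_ind)
    then have kem: "keys (e + m - ind B) = keys e \<union> F"
      by (simp add: F_def)
    have Pm: "P m \<longleftrightarrow> F \<union> A \<in> \<Delta>"
      using True m km by (auto simp: P_def hom_dom_def F_def[symmetric])
    have Pem: "P (e + m) \<longleftrightarrow> keys e \<union> F \<union> A \<in> \<Delta>"
      using True e m km face(2)[of "keys e \<union> F \<union> B" "F \<union> B"]
      by (auto simp: P_def hom_dom_def kem lookup_add)
    show ?thesis
    proof (cases "P (e + m)")
      case True
      then have "P m"
        using Pm Pem face(2)[of "keys e \<union> F \<union> A" "F \<union> A"] by auto
      moreover have "l (keys e \<union> F) = l F"
        using graded_hom_mono[OF sc l, of F "keys e \<union> F"] True \<open>P m\<close> by (auto simp: P_def kem F_def)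
      ultimately show ?thesis
        using True by (simp add: T_def kem shift mult_single I_def add.assoc flip: F_def)
    next
      case False
      have "keys (e + (m - ind B + ind A)) = keys e \<union> F \<union> A"
        using fA by (auto simp: F_def)
      then have "single (e + (m - ind B + ind A)) d \<in> I" for d
        using False Pem e m A km unfolding I_def by (intro supp_ideal_single) auto
      from supp_ideal_uminus[OF this[unfolded I_def]] have "- single (e + (m - ind B + ind A)) d \<in> I" for d
        unfolding I_def .
      then show ?thesis
        using False by (auto simp: T_def mult_single I_def)
    qed
  next
    case False
    then obtain v where v: "v \<in> B" "lookup m v = 0"
      by blast
    then have "\<not> P m"
      by (auto simp: P_def)
    moreover have "l (keys (e + m - ind B)) = 0" if Pem: "P (e + m)"
    proof -
      define F where "F = keys (e + m - ind B)"
      have F: "F \<in> hom_dom V \<Delta> A B" and kem: "keys e \<union> keys m = F \<union> B"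
        using Pem P_keys[of "e + m"] by (auto simp: P_def F_def)
      \<comment> \<open>F may contain v, whereas the vanishing condition asks for a set without v. F
        - {v} is still in the domain, and monotonicity carries the value 0 back to F.\<close>
      have F': "F - {v} \<in> hom_dom V \<Delta> A B"
        unfolding hom_dom_def
      proof (intro CollectI conjI)
        show "F - {v} \<subseteq> V"
          using F by (auto simp: hom_dom_def)
        show "F - {v} \<union> A \<in> \<Delta>"
          by (rule face(2)[of "F \<union> A"]) (use F in \<open>auto simp: hom_dom_def\<close>)
        have "F - {v} \<union> B = F \<union> B"
          using v by auto
        then show "F - {v} \<union> B \<notin> \<Delta>"
          using F by (auto simp: hom_dom_def)
      qed
      have "keys m \<subseteq> (F - {v}) \<union> (B - {v})"
        using v kem by (auto simp: in_keys_iff)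
      then have "(F - {v}) \<union> (B - {v}) \<notin> \<Delta>"
        using m(2) face(2) by blast
      then have "l (F - {v}) = 0"
        using l F' v by (auto simp: graded_hom_def)
      then show ?thesis
        using graded_hom_mono[OF sc l F' F] by (auto simp: F_def)
    qed
    ultimately show ?thesis
      by (auto simp: T_def I_def)
  qed
  have "hom_rep V I \<Phi>"
    unfolding hom_rep_def
  proof (intro conjI ballI)
    fix f
    assume f: "f \<in> I"
    show "\<Phi> f \<in> carrier (poly_ring V)"
      unfolding \<Phi>_def
    proof (rule carrier_linext)
      show "f \<in> carrier (poly_ring V)"
        using f supp_ideal_carrier by (auto simp: I_def)
      fix m :: "'v \<Rightarrow>\<^sub>0 nat"
      assume "keys m \<subseteq> V"
      then have "keys (m - ind B + ind A) \<subseteq> V"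
        using keys_diff_nat[of m "ind B"] A fA by auto
      then show "T m \<in> carrier (poly_ring V)"
        by (simp add: T_def carrier_single)
    qed
  next
    fix f g
    show "\<Phi> (f + g) - (\<Phi> f + \<Phi> g) \<in> I"
      by (simp add: \<Phi>_def linext_add I_def)
  next
    fix s f :: "('v, 'k) mpoly"
    assume s: "s \<in> carrier (poly_ring V)" and f: "f \<in> I"
    from s have "keys s \<subseteq> {m. keys m \<subseteq> V}"
      by (auto simp: carrier_poly_ring_iff)
    then show "\<Phi> (s * f) - s * \<Phi> f \<in> I"
    proof (induction s rule: mpoly_induct)
      case (single e d)
      from f[unfolded sub] show ?case
      proof (induction f rule: mpoly_induct)
        case (single m d')
        have "Const (d * d') * (T (e + m) - single e 1 * T m) \<in> I"
          unfolding I_def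
          by (rule supp_ideal_mult[OF up carrier_Const])
            (use single \<open>e \<in> _\<close> in \<open>auto intro: T_step simp flip: I_def\<close>)
        moreover have "single e d = Const d * single e 1"
          by (simp add: Const_mult_single)
        ultimately show ?case
          by (simp add: \<Phi>_def mult_single Const_mult right_diff_distrib linext_Const_mult mult_ac)
      next
        case (add p q)
        from I_add[OF add.IH] show ?case
          by (simp add: \<Phi>_def linext_add distrib_left algebra_simps)
      qed (simp add: \<Phi>_def I_def)
    next
      case (add p q)
      from I_add[OF add.IH] show ?case
        by (simp add: \<Phi>_def linext_add distrib_right algebra_simps)
    qed (simp add: \<Phi>_def I_def)
  qed
  then obtain D where D: "D \<in> Der V" "\<And>f. f \<in> I \<Longrightarrow> \<Phi> f - D f \<in> I"
    using triv by blast
  define h where "h v = D (Var v)" for v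
  have val: "l F = (\<Sum>v\<in>V. if \<forall>w. lookup (ind F + ind B - single v 1) w \<le> lookup (ind F + ind A) w
       then of_nat (lookup (ind F + ind B) v) * lookup (h v) (ind F + ind A - (ind F + ind B - single v 1)) else 0)"
    if F: "F \<in> hom_dom V \<Delta> A B" for F
  proof -
    have fF: "finite F"
      using F fin by (auto simp: hom_dom_def)
    have m: "keys (ind F + ind B) \<subseteq> V" "keys (ind F + ind B) \<notin> \<Delta>" and n: "keys (ind F + ind A) \<in> \<Delta>"
      using F B fF fA fB by (auto simp: hom_dom_def)
    then have "single (ind F + ind B) 1 \<in> I" "single (ind F + ind B) (1::'k) \<in> carrier (poly_ring V)"
      unfolding I_def by (blast intro: supp_ideal_single carrier_single)+
    from I_lookup[OF D(2)[OF this(1)] n] Der_eq_der_of[OF fin(1) D(1) this(2)]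
    have "lookup (\<Phi> (single (ind F + ind B) 1)) (ind F + ind A) =
        lookup (der_of V h (single (ind F + ind B) 1)) (ind F + ind A)"
      by (simp add: lookup_minus h_def[abs_def])
    moreover have "P (ind F + ind B)"
      using F fF fB by (auto simp: P_def lookup_add lookup_ind)
    ultimately show ?thesis
      using fF by (simp add: \<Phi>_def T_def lookup_der_of_single[OF m(1)])
  qed
  \<comment> \<open>As w is not in A, its exponent in x^F x^B exceeds the one in x^F x^A, and
    removing a factor x_v with v different from w does not change that.\<close>
  have zero: "\<not> (\<forall>w. lookup (ind F + ind B - single v 1) w \<le> lookup (ind F + ind A) w)"
    if F: "F \<in> hom_dom V \<Delta> A B" and w: "w \<in> B" "w \<noteq> v" for F v w
  proof -
    have fF: "finite F"
      using F fin by (auto simp: hom_dom_def)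
    show ?thesis
      using w B fF fA fB by (auto simp: lookup_add lookup_minus lookup_ind lookup_single when_def intro!: exI[of _ w])
  qed
  show "if is_singleton B then \<forall>F\<in>hom_dom V \<Delta> A B. \<forall>G\<in>hom_dom V \<Delta> A B. l F = l G
        else \<forall>F\<in>hom_dom V \<Delta> A B. l F = 0"
  proof (cases "is_singleton B")
    case True
    then obtain u where u: "B = {u}"
      by (auto simp: is_singleton_def)
    have "l F = lookup (h u) (ind A)" if F: "F \<in> hom_dom V \<Delta> A B" for F
    proof -
      have fF: "finite F"
        using F fin by (auto simp: hom_dom_def)
      \<comment> \<open>So x_u has exponent 1 in x^F x_u, and its derivative contributes the factor
        1 in any characteristic.\<close>
      have "u \<notin> F"
      proof
        assume "u \<in> F"
        then have "F \<union> B \<subseteq> F \<union> A"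
          using u by auto
        then show False
          using F face(2) by (auto simp: hom_dom_def)
      qed
      then have "lookup (ind F + ind B) u = 1"
        using fF u by (simp add: lookup_add lookup_ind)
      have "l F = (\<Sum>v\<in>V. if v = u then lookup (h u) (ind A) else 0)"
        unfolding val[OF F]
      proof (intro sum.cong refl)
        fix v
        assume "v \<in> V"
        show "(if \<forall>w. lookup (ind F + ind B - single v 1) w \<le> lookup (ind F + ind A) w
          then of_nat (lookup (ind F + ind B) v) * lookup (h v) (ind F + ind A - (ind F + ind B - single v 1)) else 0)
          = (if v = u then lookup (h u) (ind A) else 0)"
        proof (cases "v = u")
          case True
          then show ?thesis
            using \<open>lookup (ind F + ind B) u = 1\<close> u by (simp add: lookup_add)
        next
          case False
          then show ?thesis
            using zero[OF F, of u v] u by (subst if_not_P) auto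
        qed
      qed
      also have "\<dots> = lookup (h u) (ind A)"
        using B u fin(1) by simp
      finally show ?thesis .
    qed
    then show ?thesis
      using True by simp
  next
    case False
    have "l F = 0" if F: "F \<in> hom_dom V \<Delta> A B" for F
      unfolding val[OF F]
    proof (intro sum.neutral ballI)
      fix v
      obtain w where "w \<in> B" "w \<noteq> v"
        using False B(3) by (metis is_singletonI' is_singleton_def singletonI)
      then show "(if \<forall>w. lookup (ind F + ind B - single v 1) w \<le> lookup (ind F + ind A) w
          then of_nat (lookup (ind F + ind B) v) * lookup (h v) (ind F + ind A - (ind F + ind B - single v 1)) else 0) = 0"
        using zero[OF F] by (subst if_not_P) auto
    qed
    then show ?thesis
      using False by simp
  qed
qed

lemma rigid_iff_comb_rigid:
  assumes "simplicial_complex V \<Delta>"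
  shows "rigid TYPE('k::field) V \<Delta> \<longleftrightarrow> comb_rigid TYPE('k) V \<Delta>"
  using rigid_iff_hom_rep[OF assms, where 'k = 'k] comb_rigid_imp_hom_rep_trivial[OF assms, where 'k = 'k]
    hom_rep_trivial_imp_comb_rigid[OF assms, where 'k = 'k]
  by blast

section \<open>The circ of two complexes\<close>

lemma circ_commute: "circ V1 \<Delta>1 V2 \<Delta>2 = circ V2 \<Delta>2 V1 \<Delta>1"
  by (auto simp: circ_def)

lemma mem_circ_iff:
  "X \<subseteq> V1 \<union> V2 \<Longrightarrow> X \<in> circ V1 \<Delta>1 V2 \<Delta>2 \<longleftrightarrow> X \<inter> V1 \<in> \<Delta>1 \<or> X \<inter> V2 \<in> \<Delta>2"
  by (simp add: circ_def)

lemma simplicial_complex_circ: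
  assumes "simplicial_complex V1 \<Delta>1" "simplicial_complex V2 \<Delta>2"
  shows "simplicial_complex (V1 \<union> V2) (circ V1 \<Delta>1 V2 \<Delta>2)"
proof -
  have "G \<inter> V1 \<in> \<Delta>1" if "F \<inter> V1 \<in> \<Delta>1" "G \<subseteq> F" for F G
    using that simplicial_complexD(3)[OF assms(1), of "F \<inter> V1" "G \<inter> V1"] by blast
  moreover have "G \<inter> V2 \<in> \<Delta>2" if "F \<inter> V2 \<in> \<Delta>2" "G \<subseteq> F" for F G
    using that simplicial_complexD(3)[OF assms(2), of "F \<inter> V2" "G \<inter> V2"] by blast
  ultimately have "G \<in> circ V1 \<Delta>1 V2 \<Delta>2" if "F \<in> circ V1 \<Delta>1 V2 \<Delta>2" "G \<subseteq> F" for F G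
    using that unfolding circ_def by blast
  then show ?thesis
    unfolding simplicial_complex_def
  proof (intro conjI ballI allI impI)
    show "finite (V1 \<union> V2)"
      using simplicial_complexD(1)[OF assms(1)] simplicial_complexD(1)[OF assms(2)] by simp
    show "circ V1 \<Delta>1 V2 \<Delta>2 \<subseteq> Pow (V1 \<union> V2)" "{} \<in> circ V1 \<Delta>1 V2 \<Delta>2"
      using simplicial_complexD(4)[OF assms(1)] by (auto simp: circ_def)
  qed blast
qed

text \<open>A nonface of the circ has nonface traces on both sides, so the condition on A becomes a
  disjunction and the one on B a conjunction.\<close>

lemma hom_dom_circ:
  assumes "A \<subseteq> V1 \<union> V2" "B \<subseteq> V1 \<union> V2"
  shows "F \<in> hom_dom (V1 \<union> V2) (circ V1 \<Delta>1 V2 \<Delta>2) A B \<longleftrightarrow> F \<subseteq> V1 \<union> V2 \<and>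
    ((F \<inter> V1) \<union> (A \<inter> V1) \<in> \<Delta>1 \<or> (F \<inter> V2) \<union> (A \<inter> V2) \<in> \<Delta>2) \<and>
    (F \<inter> V1) \<union> (B \<inter> V1) \<notin> \<Delta>1 \<and> (F \<inter> V2) \<union> (B \<inter> V2) \<notin> \<Delta>2"
  using assms by (auto simp: hom_dom_def circ_def Int_Un_distrib2)

text \<open>In terms of the ideal: \<open>I\<^sub>\<Delta>\<close> is nonzero and contained in \<open>(x\<^sub>i)\<close> for some \<open>i\<close>.\<close>

definition var_divisible :: "'v set \<Rightarrow> 'v set set \<Rightarrow> bool" where
  "var_divisible V \<Delta> \<longleftrightarrow> V \<notin> \<Delta> \<and> (\<exists>i\<in>V. V - {i} \<in> \<Delta>)"

text \<open>A homomorphism on I_1 acts on I_1 I_2 through the first factor: l is pulled back along F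
  -> F \<inter> V1. It is recovered at the sets F \<union> V2, which lie in the larger domain
  because V2 is a nonface.\<close>

lemma comb_rigid_circ_imp_comb_rigid:
  assumes disj: "V1 \<inter> V2 = {}"
    and "V2 \<notin> \<Delta>2" and cr: "comb_rigid TYPE('k::zero) (V1 \<union> V2) (circ V1 \<Delta>1 V2 \<Delta>2)"
  shows "comb_rigid TYPE('k) V1 \<Delta>1"
  unfolding comb_rigid_def
proof (intro allI impI)
  fix A B and l :: "'a set \<Rightarrow> 'k"
  assume A: "A \<subseteq> V1" and B: "B \<subseteq> V1" "A \<inter> B = {}" "B \<noteq> {}" and l: "graded_hom V1 \<Delta>1 A B l"
  let ?D = "hom_dom (V1 \<union> V2) (circ V1 \<Delta>1 V2 \<Delta>2) A B"
  define l' where "l' F = l (F \<inter> V1)" for F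
  have AB: "A \<subseteq> V1 \<union> V2" "B \<subseteq> V1 \<union> V2" "A \<inter> V1 = A" "A \<inter> V2 = {}" "B \<inter> V1 = B" "B \<inter> V2 = {}"
    using A B disj by auto
  have dom: "F \<in> ?D \<longleftrightarrow> F \<subseteq> V1 \<union> V2 \<and> F \<inter> V1 \<in> hom_dom V1 \<Delta>1 A B \<and> F \<inter> V2 \<notin> \<Delta>2" for F
    unfolding hom_dom_circ[OF AB(1,2)] AB by (auto simp: hom_dom_def)
  have "graded_hom (V1 \<union> V2) (circ V1 \<Delta>1 V2 \<Delta>2) A B l'"
    unfolding graded_hom_def
  proof (intro conjI allI impI)
    fix F v
    assume "F \<in> ?D" "insert v F \<in> ?D"
    then show "l' (insert v F) = l' F"
      using l unfolding dom graded_hom_def l'_def by (cases "v \<in> V1") auto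
  next
    fix F v
    assume F: "F \<in> ?D" and v: "v \<in> B - F" and nf: "F \<union> (B - {v}) \<notin> circ V1 \<Delta>1 V2 \<Delta>2"
    have "F \<union> (B - {v}) \<subseteq> V1 \<union> V2"
      using F AB unfolding dom by blast
    then have "(F \<union> (B - {v})) \<inter> V1 \<notin> \<Delta>1"
      using nf by (simp add: mem_circ_iff)
    moreover have "(F \<union> (B - {v})) \<inter> V1 = F \<inter> V1 \<union> (B - {v})"
      using B by auto
    ultimately show "l' F = 0"
      using F v l unfolding dom graded_hom_def l'_def by auto
  qed
  note concl = cr[unfolded comb_rigid_def, rule_format, OF AB(1,2) B(2,3) this]
  have lift: "F \<union> V2 \<in> ?D" "l' (F \<union> V2) = l F" if "F \<in> hom_dom V1 \<Delta>1 A B" for F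
  proof -
    have "(F \<union> V2) \<inter> V1 = F" "(F \<union> V2) \<inter> V2 = V2"
      using that disj by (auto simp: hom_dom_def)
    then show "F \<union> V2 \<in> ?D" "l' (F \<union> V2) = l F"
      unfolding dom l'_def using that \<open>V2 \<notin> \<Delta>2\<close> by (auto simp: hom_dom_def)
  qed
  show "if is_singleton B then \<forall>F\<in>hom_dom V1 \<Delta>1 A B. \<forall>G\<in>hom_dom V1 \<Delta>1 A B. l F = l G
        else \<forall>F\<in>hom_dom V1 \<Delta>1 A B. l F = 0"
    using concl lift by (metis (full_types))
qed

text \<open>Every nonface of the circ contains both i and j, so division by x_i x_j maps I into S.
  Its degree -e_i - e_j is one where derivations contribute nothing, and it is nonzero modulo I: the
  product of all variables goes to the monomial of (V1 - {i}) \<union> (V2 - {j}), which is a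
  face.\<close>

lemma var_divisible_imp_not_comb_rigid_circ:
  assumes disj: "V1 \<inter> V2 = {}"
    and sc: "simplicial_complex V1 \<Delta>1" "simplicial_complex V2 \<Delta>2"
    and vd: "var_divisible V1 \<Delta>1" "var_divisible V2 \<Delta>2"
  shows "\<not> comb_rigid TYPE('k::zero_neq_one) (V1 \<union> V2) (circ V1 \<Delta>1 V2 \<Delta>2)"
proof
  assume cr: "comb_rigid TYPE('k) (V1 \<union> V2) (circ V1 \<Delta>1 V2 \<Delta>2)"
  obtain i j where i: "i \<in> V1" "V1 - {i} \<in> \<Delta>1" "V1 \<notin> \<Delta>1" and j: "j \<in> V2" "V2 - {j} \<in> \<Delta>2" "V2 \<notin> \<Delta>2"
    using vd by (auto simp: var_divisible_def)
  have ij: "i \<noteq> j" "i \<notin> V2" "j \<notin> V1"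
    using i j disj by auto
  have face1: "F \<inter> V1 \<in> \<Delta>1" if "i \<notin> F" for F
    using that by (intro simplicial_complexD(3)[OF sc(1) i(2)]) auto
  have face2: "F \<inter> V2 \<in> \<Delta>2" if "j \<notin> F" for F
    using that by (intro simplicial_complexD(3)[OF sc(2) j(2)]) auto
  have "graded_hom (V1 \<union> V2) (circ V1 \<Delta>1 V2 \<Delta>2) {} {i, j} (\<lambda>F. 1 :: 'k)"
    unfolding graded_hom_def
  proof (intro conjI allI impI refl)
    fix F v
    assume F: "F \<in> hom_dom (V1 \<union> V2) (circ V1 \<Delta>1 V2 \<Delta>2) {} {i, j}"
      and v: "v \<in> {i, j} - F" and nf: "F \<union> ({i, j} - {v}) \<notin> circ V1 \<Delta>1 V2 \<Delta>2"
    have "v \<notin> F \<union> ({i, j} - {v})" "F \<union> ({i, j} - {v}) \<subseteq> V1 \<union> V2"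
      using v F i j by (auto simp: hom_dom_def)
    then have False
      using nf face1[of "F \<union> ({i, j} - {v})"] face2[of "F \<union> ({i, j} - {v})"] v
      by (auto simp: mem_circ_iff)
    then show "(1::'k) = 0" ..
  qed
  moreover have "\<not> is_singleton {i, j}"
    using ij by (auto simp: is_singleton_def)
  moreover have "(V1 - {i}) \<union> (V2 - {j}) \<in> hom_dom (V1 \<union> V2) (circ V1 \<Delta>1 V2 \<Delta>2) {} {i, j}"
  proof -
    have "((V1 - {i}) \<union> (V2 - {j})) \<inter> V1 = V1 - {i}" "((V1 - {i}) \<union> (V2 - {j})) \<inter> V2 = V2 - {j}"
      "V1 - {i} \<union> {i, j} \<inter> V1 = V1" "V2 - {j} \<union> {i, j} \<inter> V2 = V2"
      using disj i j ij by auto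
    then show ?thesis
      using i j by (subst hom_dom_circ) auto
  qed
  ultimately show False
    using comb_rigid_zeroD[OF cr, of "{}" "{i, j}" "\<lambda>F. 1"] i j by auto
qed

text \<open>Since F' \<union> (B \<inter> V2) is a nonface, the trace on V1 alone decides whether
  the sets in the two conditions are nonfaces of the circ.\<close>

lemma graded_hom_circ_slice:
  assumes disj: "V1 \<inter> V2 = {}" and AB: "A \<subseteq> V1 \<union> V2" "B \<subseteq> V1 \<union> V2"
    and l: "graded_hom (V1 \<union> V2) (circ V1 \<Delta>1 V2 \<Delta>2) A B l"
    and F': "F' \<subseteq> V2" "F' \<union> (B \<inter> V2) \<notin> \<Delta>2"
  shows "graded_hom V1 \<Delta>1 (A \<inter> V1) (B \<inter> V1) (\<lambda>F. l (F \<union> F'))"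
proof -
  let ?D = "hom_dom (V1 \<union> V2) (circ V1 \<Delta>1 V2 \<Delta>2) A B"
  have dom: "F \<union> F' \<in> ?D" "(F \<union> F') \<inter> V1 = F" "(F \<union> F') \<inter> V2 = F'" "F \<subseteq> V1"
    if "F \<in> hom_dom V1 \<Delta>1 (A \<inter> V1) (B \<inter> V1)" for F
  proof -
    show *: "(F \<union> F') \<inter> V1 = F" "(F \<union> F') \<inter> V2 = F'" "F \<subseteq> V1"
      using that F' disj by (auto simp: hom_dom_def)
    show "F \<union> F' \<in> ?D"
      using that F' unfolding hom_dom_circ[OF AB] * by (auto simp: hom_dom_def)
  qed
  show ?thesis
    unfolding graded_hom_def
  proof (intro conjI allI impI)
    fix F v
    assume "F \<in> hom_dom V1 \<Delta>1 (A \<inter> V1) (B \<inter> V1)" "insert v F \<in> hom_dom V1 \<Delta>1 (A \<inter> V1) (B \<inter> V1)"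
    then show "l (insert v F \<union> F') = l (F \<union> F')"
      using l dom(1)[of F] dom(1)[of "insert v F"] by (simp add: graded_hom_def)
  next
    fix F v
    assume F: "F \<in> hom_dom V1 \<Delta>1 (A \<inter> V1) (B \<inter> V1)" and v: "v \<in> B \<inter> V1 - F"
      and nf: "F \<union> (B \<inter> V1 - {v}) \<notin> \<Delta>1"
    have "(F \<union> F' \<union> (B - {v})) \<inter> V1 = F \<union> (B \<inter> V1 - {v})" "(F \<union> F' \<union> (B - {v})) \<inter> V2 = F' \<union> (B \<inter> V2)"
      using v dom(2-4)[OF F] disj by auto
    then have "F \<union> F' \<union> (B - {v}) \<notin> circ V1 \<Delta>1 V2 \<Delta>2"
      using nf F' by (auto simp: circ_def)
    moreover have "v \<in> B - (F \<union> F')"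
      using v F' disj by auto
    ultimately show "l (F \<union> F') = 0"
      using l dom(1)[OF F] unfolding graded_hom_def by blast
  qed
qed

text \<open>Enlarging the second part to V2 stays in the domain, so monotonicity reduces to F' = G'
  = V2, and rigidity of \<Delta>1 applies to that slice. It gives a constant or 0 according to the
  size of B \<inter> V1, which is nonempty because the domain over V1 contains F.\<close>

lemma graded_hom_circ_const:
  fixes l :: "'v set \<Rightarrow> 'k::zero"
  assumes disj: "V1 \<inter> V2 = {}" and sc: "simplicial_complex V1 \<Delta>1" "simplicial_complex V2 \<Delta>2"
    and AB: "A \<subseteq> V1 \<union> V2" "B \<subseteq> V1 \<union> V2" "A \<inter> B = {}"
    and l: "graded_hom (V1 \<union> V2) (circ V1 \<Delta>1 V2 \<Delta>2) A B l"
    and cr: "comb_rigid TYPE('k) V1 \<Delta>1" and "V2 \<notin> \<Delta>2"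
    and F: "F \<in> hom_dom V1 \<Delta>1 (A \<inter> V1) (B \<inter> V1)" "F' \<subseteq> V2" "F' \<union> (B \<inter> V2) \<notin> \<Delta>2"
    and G: "G \<in> hom_dom V1 \<Delta>1 (A \<inter> V1) (B \<inter> V1)" "G' \<subseteq> V2" "G' \<union> (B \<inter> V2) \<notin> \<Delta>2"
  shows "l (F \<union> F') = l (G \<union> G')"
proof -
  have sc': "simplicial_complex (V1 \<union> V2) (circ V1 \<Delta>1 V2 \<Delta>2)"
    using sc by (rule simplicial_complex_circ)
  have V2: "V2 \<union> (B \<inter> V2) \<notin> \<Delta>2"
    using \<open>V2 \<notin> \<Delta>2\<close> by (simp add: Un_absorb2)
  have top: "l (X \<union> X') = l (X \<union> V2)"
    if X: "X \<in> hom_dom V1 \<Delta>1 (A \<inter> V1) (B \<inter> V1)" "X' \<subseteq> V2" "X' \<union> (B \<inter> V2) \<notin> \<Delta>2" for X X'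
  proof (rule graded_hom_mono[OF sc' l])
    have "X \<union> Y \<in> hom_dom (V1 \<union> V2) (circ V1 \<Delta>1 V2 \<Delta>2) A B" if "Y \<subseteq> V2" "Y \<union> (B \<inter> V2) \<notin> \<Delta>2" for Y
    proof -
      have *: "(X \<union> Y) \<inter> V1 = X" "(X \<union> Y) \<inter> V2 = Y"
        using that X disj by (auto simp: hom_dom_def)
      show ?thesis
        unfolding hom_dom_circ[OF AB(1,2)] * using X that by (auto simp: hom_dom_def)
    qed
    then show "X \<union> X' \<in> hom_dom (V1 \<union> V2) (circ V1 \<Delta>1 V2 \<Delta>2) A B"
      "X \<union> V2 \<in> hom_dom (V1 \<union> V2) (circ V1 \<Delta>1 V2 \<Delta>2) A B"
      using X V2 by auto
  qed (use X in auto)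
  have slice: "graded_hom V1 \<Delta>1 (A \<inter> V1) (B \<inter> V1) (\<lambda>F. l (F \<union> V2))"
    using graded_hom_circ_slice[OF disj AB(1,2) l subset_refl V2] .
  have "l (F \<union> V2) = l (G \<union> V2)"
  proof (cases "is_singleton (B \<inter> V1)")
    case True
    then obtain v where v: "B \<inter> V1 = {v}"
      by (auto simp: is_singleton_def)
    then have "v \<in> V1" "v \<notin> A \<inter> V1"
      using AB by auto
    from comb_rigid_singletonD[OF cr _ this slice[unfolded v] F(1)[unfolded v] G(1)[unfolded v]]
    show ?thesis
      by simp
  next
    case False
    have "B \<inter> V1 \<noteq> {}"
    proof
      assume "B \<inter> V1 = {}"
      then show False
        using F(1) simplicial_complexD(3)[OF sc(1), of "F \<union> (A \<inter> V1)" F] by (auto simp: hom_dom_def)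
    qed
    moreover have "A \<inter> V1 \<inter> (B \<inter> V1) = {}"
      using AB by auto
    ultimately show ?thesis
      using comb_rigid_zeroD[OF cr _ _ _ _ False slice] F(1) G(1) by simp
  qed
  then show ?thesis
    using top[OF F] top[OF G] by simp
qed

lemma comb_rigid_circ:
  assumes disj: "V1 \<inter> V2 = {}" and sc: "simplicial_complex V1 \<Delta>1" "simplicial_complex V2 \<Delta>2"
    and cr: "comb_rigid TYPE('k::zero) V1 \<Delta>1" "comb_rigid TYPE('k) V2 \<Delta>2"
    and nvd: "\<not> var_divisible V1 \<Delta>1"
  shows "comb_rigid TYPE('k) (V1 \<union> V2) (circ V1 \<Delta>1 V2 \<Delta>2)"
  unfolding comb_rigid_def
proof (intro allI impI)
  fix A B and l :: "'a set \<Rightarrow> 'k"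
  assume AB: "A \<subseteq> V1 \<union> V2" "B \<subseteq> V1 \<union> V2" "A \<inter> B = {}" "B \<noteq> {}"
    and l: "graded_hom (V1 \<union> V2) (circ V1 \<Delta>1 V2 \<Delta>2) A B l"
  let ?D = "hom_dom (V1 \<union> V2) (circ V1 \<Delta>1 V2 \<Delta>2) A B"
  let ?A1 = "A \<inter> V1" and ?A2 = "A \<inter> V2" and ?B1 = "B \<inter> V1" and ?B2 = "B \<inter> V2"
  let ?D1 = "hom_dom V1 \<Delta>1 ?A1 ?B1" and ?D2 = "hom_dom V2 \<Delta>2 ?A2 ?B2"
  define U1 where "U1 = {F. F \<subseteq> V1 \<and> F \<union> ?B1 \<notin> \<Delta>1}"
  define U2 where "U2 = {F. F \<subseteq> V2 \<and> F \<union> ?B2 \<notin> \<Delta>2}"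
  have disj': "V2 \<inter> V1 = {}"
    using disj by auto
  have AB': "A \<subseteq> V2 \<union> V1" "B \<subseteq> V2 \<union> V1"
    using AB by auto
  have l': "graded_hom (V2 \<union> V1) (circ V2 \<Delta>2 V1 \<Delta>1) A B l"
    using l by (simp add: circ_commute[of V2] Un_commute[of V2])
  have DU: "F \<in> ?D1 \<Longrightarrow> F \<in> U1" "F \<in> ?D2 \<Longrightarrow> F \<in> U2" for F
    by (auto simp: hom_dom_def U1_def U2_def)
  have split: "\<exists>F1 F2. F = F1 \<union> F2 \<and> (F1 \<in> ?D1 \<and> F2 \<in> U2 \<or> F1 \<in> U1 \<and> F2 \<in> ?D2)" if "F \<in> ?D" for F
  proof (intro exI conjI)
    show "F = (F \<inter> V1) \<union> (F \<inter> V2)"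
      using that by (auto simp: hom_dom_def)
    show "F \<inter> V1 \<in> ?D1 \<and> F \<inter> V2 \<in> U2 \<or> F \<inter> V1 \<in> U1 \<and> F \<inter> V2 \<in> ?D2"
      using that unfolding hom_dom_circ[OF AB(1,2)] by (auto simp: hom_dom_def U1_def U2_def)
  qed
  show "if is_singleton B then \<forall>F\<in>?D. \<forall>G\<in>?D. l F = l G else \<forall>F\<in>?D. l F = 0"
  proof (cases "V1 \<in> \<Delta>1 \<or> V2 \<in> \<Delta>2")
    case True
    then have "\<And>F. F \<subseteq> V1 \<Longrightarrow> F \<in> \<Delta>1 \<or> (\<forall>F\<subseteq>V2. F \<in> \<Delta>2)"
      using simplicial_complexD(3)[OF sc(1)] simplicial_complexD(3)[OF sc(2)] by blast
    \<comment> \<open>Here the circ is a full simplex, so adding B never produces a nonface.\<close>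
    then have "?D = {}"
      unfolding set_eq_iff hom_dom_circ[OF AB(1,2)] by (metis Int_lower2 Un_least empty_iff)
    then show ?thesis
      by simp
  next
    case False
    then have V: "V1 \<notin> \<Delta>1" "V2 \<notin> \<Delta>2"
      by auto
    have const1: "l (F \<union> F') = l (G \<union> G')" if "F \<in> ?D1" "F' \<in> U2" "G \<in> ?D1" "G' \<in> U2" for F F' G G'
      using graded_hom_circ_const[OF disj sc AB(1-3) l cr(1) V(2)] that by (simp add: U2_def)
    have const2: "l (F \<union> F') = l (G \<union> G')" if "F \<in> U1" "F' \<in> ?D2" "G \<in> U1" "G' \<in> ?D2" for F F' G G'
      using graded_hom_circ_const[OF disj' sc(2,1) AB' AB(3) l' cr(2) V(1), of F' F G' G] that
      by (simp add: U1_def Un_commute)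
    have D_empty: "?B1 = {} \<Longrightarrow> ?D1 = {}" "?B2 = {} \<Longrightarrow> ?D2 = {}"
      using simplicial_complexD(3)[OF sc(1)] simplicial_complexD(3)[OF sc(2)]
      by (auto simp: hom_dom_def)
    show ?thesis
    proof (cases "is_singleton B")
      case True
      \<comment> \<open>B misses one side, whose piece of the domain is then empty; a single
        constant remains.\<close>
      then consider "?B1 = {}" | "?B2 = {}"
        using disj by (auto simp: is_singleton_def)
      then have "l F = l G" if "F \<in> ?D" "G \<in> ?D" for F G
      proof cases
        case 1
        then show ?thesis
          using split[OF that(1)] split[OF that(2)] D_empty const2 by blast
      next
        case 2
        then show ?thesis
          using split[OF that(1)] split[OF that(2)] D_empty const1 by blast
      qed
      then show ?thesis
        unfolding if_P[OF True] by blast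
    next
      case ns: False
      have zero1: "l (F \<union> F') = 0" if F: "F \<in> ?D1" "F' \<in> U2" and "?B2 = {}" for F F'
      proof -
        have "?B1 = B"
          using AB that by auto
        moreover have "graded_hom V1 \<Delta>1 ?A1 ?B1 (\<lambda>F. l (F \<union> F'))"
          using graded_hom_circ_slice[OF disj AB(1,2) l] F by (auto simp: U2_def)
        ultimately show ?thesis
          using comb_rigid_zeroD[OF cr(1), of ?A1 ?B1 "\<lambda>F. l (F \<union> F')" F] F ns AB by auto
      qed
      have zero2: "l (F \<union> F') = 0" if F: "F \<in> U1" "F' \<in> ?D2" and "?B1 = {}" for F F'
      proof -
        have "?B2 = B"
          using AB that by auto
        moreover have "graded_hom V2 \<Delta>2 ?A2 ?B2 (\<lambda>F'. l (F' \<union> F))"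
          using graded_hom_circ_slice[OF disj' AB' l'] F by (auto simp: U1_def)
        ultimately show ?thesis
          using comb_rigid_zeroD[OF cr(2), of ?A2 ?B2 "\<lambda>F'. l (F' \<union> F)" F'] F ns AB
          by (auto simp: Un_commute)
      qed
      have "l F = 0" if "F \<in> ?D" for F
      proof (cases "?B1 = {} \<or> ?B2 = {}")
        case True
        then show ?thesis
          using split[OF that] zero1 zero2 D_empty by blast
      next
        case False
        then obtain v w where v: "v \<in> B" "v \<in> V1" and w: "w \<in> B" "w \<in> V2"
          by blast
        have vw: "v \<notin> A" "w \<notin> A" "v \<notin> V2" "w \<notin> V1"
          using v w AB disj by auto
        have X1: "V1 - {v} \<notin> \<Delta>1"
          using nvd V v by (auto simp: var_divisible_def)
        have "(V1 - {v}) \<union> ?B1 = V1" "(V2 - {w}) \<union> ?B2 = V2"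
          using v w by auto
        then have U: "V1 - {v} \<in> U1" "V2 - {w} \<in> U2"
          using V by (auto simp: U1_def U2_def)
        have D2: "V2 - {w} \<in> ?D2" if "V2 - {w} \<in> \<Delta>2"
        proof -
          have "(V2 - {w}) \<union> ?A2 = V2 - {w}"
            using vw by auto
          then show ?thesis
            using that U by (simp add: hom_dom_def U2_def)
        qed
        have part2: "l (F1 \<union> F2) = 0" if F: "F1 \<in> U1" "F2 \<in> ?D2" for F1 F2
        proof -
          let ?G = "(V1 - {v}) \<union> F2"
          have F2: "F2 \<subseteq> V2"
            using F by (auto simp: hom_dom_def)
          have G: "?G \<inter> V1 = V1 - {v}" "?G \<inter> V2 = F2"
            using F2 disj by auto
          have "?G \<in> ?D"
            unfolding hom_dom_circ[OF AB(1,2)] G using F U F2 by (auto simp: hom_dom_def U1_def)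
          moreover have "?G \<union> (B - {v}) \<notin> circ V1 \<Delta>1 V2 \<Delta>2"
          proof -
            have "(?G \<union> (B - {v})) \<inter> V1 = V1 - {v}" "(?G \<union> (B - {v})) \<inter> V2 = F2 \<union> ?B2"
              using F2 disj vw by auto
            then show ?thesis
              using X1 F by (auto simp: circ_def hom_dom_def)
          qed
          moreover have "v \<in> B - ?G"
            using v vw F2 by auto
          ultimately have "l ?G = 0"
            using l unfolding graded_hom_def by blast
          then show ?thesis
            using const2[OF F U(1) F(2)] by simp
        qed
        \<comment> \<open>On \<open>D\<^sub>1 \<times> U\<^sub>2\<close>, move the second part to V2
          - {w}. If this is a nonface, the argument of \<open>part2\<close> works with w; if it is a
          face, the new point also lies in the other piece, where l is already 0.\<close>
        have part1: "l (F1 \<union> F2) = 0" if F: "F1 \<in> ?D1" "F2 \<in> U2" for F1 F2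
        proof -
          let ?G = "F1 \<union> (V2 - {w})"
          have F1: "F1 \<subseteq> V1"
            using F by (auto simp: hom_dom_def)
          have "l ?G = 0"
          proof (cases "V2 - {w} \<in> \<Delta>2")
            case True
            then show ?thesis
              using part2 D2 F DU by blast
          next
            case X2: False
            have G: "?G \<inter> V1 = F1" "?G \<inter> V2 = V2 - {w}"
              using F1 disj by auto
            have "?G \<in> ?D"
              unfolding hom_dom_circ[OF AB(1,2)] G using F U F1 by (auto simp: hom_dom_def U2_def)
            moreover have "?G \<union> (B - {w}) \<notin> circ V1 \<Delta>1 V2 \<Delta>2"
            proof -
              have "(?G \<union> (B - {w})) \<inter> V1 = F1 \<union> ?B1" "(?G \<union> (B - {w})) \<inter> V2 = V2 - {w}"
                using F1 disj vw by auto
              then show ?thesis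
                using X2 F by (auto simp: circ_def hom_dom_def)
            qed
            moreover have "w \<in> B - ?G"
              using w vw F1 by auto
            ultimately show ?thesis
              using l unfolding graded_hom_def by blast
          qed
          then show ?thesis
            using const1[OF F F(1) U(2)] by simp
        qed
        show ?thesis
          using split[OF that] part1 part2 by blast
      qed
      then show ?thesis
        unfolding if_not_P[OF ns] by blast
    qed
  qed
qed

section \<open>Special links and monomial localizations\<close>

text \<open>If {i} is not a face, F = {} works. Otherwise let F be a facet of the link of i; a face
  of the link of F containing i can then only be {i}. With I = x_i J, the variables outside
  \<open>insert i F\<close> generate a minimal prime of J, and \<open>insert i F \<noteq> V\<close>
  keeps it nonzero. Links and localizations both depend only on which G \<union> F are faces, so
  this form serves for both.\<close>

lemma var_divisible_obtain:
  assumes sc: "simplicial_complex V \<Delta>" and vd: "var_divisible V \<Delta>"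
  obtains F i where "F \<in> \<Delta>" "i \<in> V - F"
    "(\<forall>G\<subseteq>V - F. G \<union> F \<in> \<Delta> \<longleftrightarrow> i \<notin> G) \<or>
     insert i F \<noteq> V \<and> (\<forall>G\<subseteq>V - F. G \<union> F \<in> \<Delta> \<longleftrightarrow> i \<notin> G \<or> G = {i})"
proof -
  note face = simplicial_complexD(2,3)[OF sc]
  obtain i where i: "i \<in> V" "V - {i} \<in> \<Delta>" "V \<notin> \<Delta>"
    using vd by (auto simp: var_divisible_def)
  have faceI: "G \<in> \<Delta>" if "G \<subseteq> V" "i \<notin> G" for G
    using that face(2)[OF i(2)] by blast
  show ?thesis
  proof (cases "{i} \<in> \<Delta>")
    case False
    show ?thesis
    proof (rule that[of "{}" i])
      have "i \<notin> G" if "G \<in> \<Delta>" for G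
        using that False face(2)[of G "{i}"] by auto
      then show "(\<forall>G\<subseteq>V - {}. G \<union> {} \<in> \<Delta> \<longleftrightarrow> i \<notin> G) \<or>
          insert i {} \<noteq> V \<and> (\<forall>G\<subseteq>V - {}. G \<union> {} \<in> \<Delta> \<longleftrightarrow> i \<notin> G \<or> G = {i})"
        using faceI by auto
    qed (use i simplicial_complexD(4)[OF sc] in auto)
  next
    case True
    define M where "M = {F. F \<subseteq> V - {i} \<and> insert i F \<in> \<Delta>}"
    have "finite M"
      by (rule finite_subset[of _ "Pow V"]) (use simplicial_complexD(1)[OF sc] in \<open>auto simp: M_def\<close>)
    moreover have "{} \<in> M"
      using True by (simp add: M_def)
    ultimately have "\<exists>F\<in>M. {} \<subseteq> F \<and> (\<forall>G\<in>M. F \<subseteq> G \<longrightarrow> F = G)"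
      by (rule finite_has_maximal2)
    then obtain F where F: "F \<in> M" "\<forall>G\<in>M. F \<subseteq> G \<longrightarrow> F = G"
      by (elim bexE conjE)
    note FM = F(1)[unfolded M_def]
    have max: "G = {i}" if G: "G \<subseteq> V - F" "i \<in> G" "G \<union> F \<in> \<Delta>" for G
    proof -
      have eq: "insert i (F \<union> (G - {i})) = G \<union> F"
        using G by auto
      have "F \<union> (G - {i}) \<in> M"
        unfolding M_def mem_Collect_eq eq using G FM by auto
      then have "F = F \<union> (G - {i})"
        using F(2) by simp
      then show ?thesis
        using G by auto
    qed
    show ?thesis
    proof (rule that[of F i])
      show "F \<in> \<Delta>" "i \<in> V - F"
        using FM faceI i by auto
      have "G \<union> F \<in> \<Delta>" if "G \<subseteq> V - F" "i \<notin> G" for G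
        using that FM by (intro faceI) auto
      moreover have "{i} \<union> F \<in> \<Delta>"
        using FM by simp
      ultimately have "\<forall>G\<subseteq>V - F. G \<union> F \<in> \<Delta> \<longleftrightarrow> i \<notin> G \<or> G = {i}"
        using max by blast
      moreover have "insert i F \<noteq> V"
        using FM i by auto
      ultimately show "(\<forall>G\<subseteq>V - F. G \<union> F \<in> \<Delta> \<longleftrightarrow> i \<notin> G) \<or>
          insert i F \<noteq> V \<and> (\<forall>G\<subseteq>V - F. G \<union> F \<in> \<Delta> \<longleftrightarrow> i \<notin> G \<or> G = {i})"
        by blast
    qed
  qed
qed

section \<open>Special links\<close>

lemma facets_Pow: "facets (Pow X) = {X}"
  by (auto simp: facets_def)

lemma facets_insert_Pow:
  assumes "X \<noteq> {}" "i \<notin> X"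
  shows "facets (insert {i} (Pow X)) = {{i}, X}"
proof -
  have "F \<in> facets (insert {i} (Pow X)) \<longleftrightarrow> F = {i} \<or> F = X" for F
  proof
    assume "F \<in> facets (insert {i} (Pow X))"
    then have "F = {i} \<or> F \<subseteq> X" "F \<subseteq> X \<longrightarrow> X = F"
      by (auto simp: facets_def)
    then show "F = {i} \<or> F = X"
      by auto
  next
    have "\<not> X \<subseteq> {i}" "\<not> {i} \<subseteq> X"
      using assms by auto
    then show "F = {i} \<or> F = X \<Longrightarrow> F \<in> facets (insert {i} (Pow X))"
      by (auto simp: facets_def)
  qed
  then show ?thesis
    by blast
qed

text \<open>In both special shapes V - F - {i} is a facet of the link, which makes V - {i} a face; V
  is not one, since V - F would then be a strictly larger face of the link. Conversely, the link of
  the F from \<open>var_divisible_obtain\<close> is the full simplex on V - F - {i}, possibly with i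
  as an additional isolated vertex.\<close>

lemma ex_special_link_iff:
  assumes sc: "simplicial_complex V \<Delta>"
  shows "(\<exists>F\<in>\<Delta>. special (V - F) (link \<Delta> F)) \<longleftrightarrow> var_divisible V \<Delta>"
proof
  note face = simplicial_complexD(2,3)[OF sc]
  assume "\<exists>F\<in>\<Delta>. special (V - F) (link \<Delta> F)"
  then obtain F i where F: "F \<in> \<Delta>" and i: "i \<in> V - F" and fac: "V - F - {i} \<in> facets (link \<Delta> F)"
    by (auto simp: special_def)
  have "V - F - {i} \<in> link \<Delta> F"
    using fac by (simp add: facets_def)
  then have "V - F - {i} \<union> F \<in> \<Delta>"
    by (simp add: link_def)
  moreover have "V - F - {i} \<union> F = V - {i}"
    using i face(1)[OF F] by auto
  moreover have "V \<notin> \<Delta>"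
  proof
    assume V: "V \<in> \<Delta>"
    have "V - F \<union> F = V"
      using face(1)[OF F] by auto
    then have "V - F \<in> link \<Delta> F"
      using V face(2)[OF V, of "V - F"] by (auto simp: link_def)
    then show False
      using fac i unfolding facets_def by blast
  qed
  ultimately show "var_divisible V \<Delta>"
    using i by (auto simp: var_divisible_def)
next
  note face = simplicial_complexD(2,3)[OF sc]
  assume "var_divisible V \<Delta>"
  with sc obtain F i where F: "F \<in> \<Delta>" "i \<in> V - F"
    and cases: "(\<forall>G\<subseteq>V - F. G \<union> F \<in> \<Delta> \<longleftrightarrow> i \<notin> G) \<or>
     insert i F \<noteq> V \<and> (\<forall>G\<subseteq>V - F. G \<union> F \<in> \<Delta> \<longleftrightarrow> i \<notin> G \<or> G = {i})"
    by (rule var_divisible_obtain)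
  have link: "G \<in> link \<Delta> F \<longleftrightarrow> G \<subseteq> V - F \<and> G \<union> F \<in> \<Delta>" for G
    using face(1)[of "G \<union> F"] face(2)[of "G \<union> F" G] by (auto simp: link_def)
  have "special (V - F) (link \<Delta> F)"
    using cases
  proof
    assume "\<forall>G\<subseteq>V - F. G \<union> F \<in> \<Delta> \<longleftrightarrow> i \<notin> G"
    then have *: "G \<in> link \<Delta> F \<longleftrightarrow> G \<in> Pow (V - F - {i})" for G
      unfolding link by blast
    have "link \<Delta> F = Pow (V - F - {i})"
      by (rule Set.set_eqI) (rule *)
    then have "facets (link \<Delta> F) = {V - F - {i}}"
      by (simp add: facets_Pow)
    then show ?thesis
      using F(2) by (auto simp: special_def)
  next
    assume asm: "insert i F \<noteq> V \<and> (\<forall>G\<subseteq>V - F. G \<union> F \<in> \<Delta> \<longleftrightarrow> i \<notin> G \<or> G = {i})"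
    then have *: "G \<in> link \<Delta> F \<longleftrightarrow> G \<in> insert {i} (Pow (V - F - {i}))" for G
      unfolding link using F(2) by blast
    have eq: "link \<Delta> F = insert {i} (Pow (V - F - {i}))"
      by (rule Set.set_eqI) (rule *)
    have ne: "V - F - {i} \<noteq> {}"
      using asm F face(1)[OF F(1)] by auto
    have "facets (link \<Delta> F) = {{i}, V - F - {i}}"
      unfolding eq using ne by (rule facets_insert_Pow) simp
    then show ?thesis
      using F(2) by (auto simp: special_def)
  qed
  with F(1) show "\<exists>F\<in>\<Delta>. special (V - F) (link \<Delta> F)"
    by blast
qed

section \<open>Monomial localizations\<close>

lemma subst_vars_eq_linext:
  "subst_vars \<sigma> = linext (\<lambda>m. \<Prod>v\<in>keys m. \<sigma> v ^ lookup m v)"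
  by (simp add: subst_vars_def linext_def fun_eq_iff)

lemma Var_power: "Var v ^ k = single (single v k) 1"
  by (induction k) (simp_all add: Var_def mult_single flip: single_add)

lemma localize_monomial:
  obtains r where "(\<Prod>v\<in>keys m. (if v \<in> A then Var v else 1) ^ lookup m v) = single r (1::'k::field)"
    and "\<And>v. lookup r v = (if v \<in> A then lookup m v else 0)"
proof -
  have "finite X \<Longrightarrow> \<exists>r. (\<Prod>v\<in>X. (if v \<in> A then Var v else 1) ^ lookup m v) = single r (1::'k) \<and>
      (\<forall>v. lookup r v = (if v \<in> X \<inter> A then lookup m v else 0))" for X
  proof (induction X rule: finite_induct)
    case empty
    show ?case
      by (rule exI[of _ 0]) simp
  next
    case (insert x X)
    then obtain r where r: "(\<Prod>v\<in>X. (if v \<in> A then Var v else 1) ^ lookup m v) = single r (1::'k)"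
      "\<And>v. lookup r v = (if v \<in> X \<inter> A then lookup m v else 0)"
      by blast
    have "(if x \<in> A then Var x else 1) ^ lookup m x = single (if x \<in> A then single x (lookup m x) else 0) (1::'k)"
      by (simp add: Var_power)
    then show ?case
      using insert r
      by (intro exI[of _ "(if x \<in> A then single x (lookup m x) else 0) + r"])
        (auto simp: mult_single lookup_add lookup_single when_def)
  qed
  from this[OF finite_keys, of m] obtain r where
    r: "(\<Prod>v\<in>keys m. (if v \<in> A then Var v else 1) ^ lookup m v) = single r (1::'k)"
      "\<And>v. lookup r v = (if v \<in> keys m \<inter> A then lookup m v else 0)"
    by blast
  have "lookup r v = (if v \<in> A then lookup m v else 0)" for v
    by (simp add: r(2) in_keys_iff)
  then show ?thesis
    using that r(1) by blast
qed

text \<open>The variables outside A become 1, so a monomial in the variables of A is reached iff its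
  product with all the others lies in I. If V - A is a face, the result is the Stanley-Reisner ideal
  of its link.\<close>

lemma mono_localization_eq:
  assumes sc: "simplicial_complex V \<Delta>" and A: "A \<subseteq> V"
  shows "mono_localization (SR_ideal V \<Delta> :: ('v, 'k::field) mpoly set) A = supp_ideal A {N. N \<union> (V - A) \<notin> \<Delta>}"
  unfolding mono_localization_def SR_ideal_eq[OF sc]
proof (rule genideal_eq_supp_ideal)
  note face = simplicial_complexD(2,3)[OF sc]
  let ?N = "{N. N \<union> (V - A) \<notin> \<Delta>}"
  let ?\<sigma> = "\<lambda>i. if i \<in> A then Var i else 1 :: ('v, 'k) mpoly"
  show up: "upset_on A ?N"
    unfolding upset_on_def using face(2) by (metis (no_types, lifting) Un_mono mem_Collect_eq subset_refl)
  show "subst_vars ?\<sigma> ` supp_ideal V (- \<Delta>) \<subseteq> supp_ideal A ?N"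
  proof (clarify)
    fix p :: "('v, 'k) mpoly"
    assume "p \<in> supp_ideal V (- \<Delta>)"
    then have "keys p \<subseteq> {m. keys m \<subseteq> V \<and> keys m \<notin> \<Delta>}"
      by (auto simp: supp_ideal_def)
    then show "subst_vars ?\<sigma> p \<in> supp_ideal A ?N"
    proof (induction p rule: mpoly_induct)
      case (single m c)
      obtain r where r: "(\<Prod>v\<in>keys m. ?\<sigma> v ^ lookup m v) = single r 1"
        "\<And>v. lookup r v = (if v \<in> A then lookup m v else 0)"
        using localize_monomial[where m = m and A = A] by blast
      have kr: "keys r = keys m \<inter> A"
        by (auto simp: in_keys_iff r(2) split: if_splits)
      have "keys m \<subseteq> keys r \<union> (V - A)"
        using single kr by auto
      then have "keys r \<union> (V - A) \<notin> \<Delta>"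
        using single face(2) by blast
      then show ?case
        using kr by (auto simp: subst_vars_eq_linext r(1) Const_mult_single intro!: supp_ideal_single)
    qed (auto simp: subst_vars_eq_linext linext_add intro: supp_ideal_add)
  qed
  fix m :: "'v \<Rightarrow>\<^sub>0 nat"
  assume m: "keys m \<subseteq> A" "keys m \<in> ?N"
  define m' where "m' = m + ind (V - A)"
  have fin: "finite (V - A)"
    using simplicial_complexD(1)[OF sc] by simp
  obtain r where r: "(\<Prod>v\<in>keys m'. ?\<sigma> v ^ lookup m' v) = single r 1"
    "\<And>v. lookup r v = (if v \<in> A then lookup m' v else 0)"
    using localize_monomial[where m = m' and A = A] by blast
  have "r = m"
    using m(1) by (intro poly_mapping_eqI) (auto simp: r m'_def lookup_add lookup_ind[OF fin] in_keys_iff)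
  then have "subst_vars ?\<sigma> (single m' 1) = single m 1"
    using r(1) by (simp add: subst_vars_eq_linext)
  moreover have "single m' 1 \<in> supp_ideal V (- \<Delta>)"
    using m A fin by (intro supp_ideal_single) (auto simp: m'_def)
  ultimately show "\<exists>q\<in>carrier (poly_ring A). \<exists>s\<in>subst_vars ?\<sigma> ` supp_ideal V (- \<Delta>). single m (1::'k) = q * s"
    by (intro bexI[of _ 1] bexI[of _ "single m 1"]) (auto intro!: image_eqI[of _ _ "single m' 1"])
qed

lemma genideal_Var_eq:
  assumes "B \<subseteq> A"
  shows "genideal (poly_ring A) (Var ` B) = supp_ideal A {N. N \<inter> B \<noteq> {}}"
proof (rule genideal_eq_supp_ideal)
  show "upset_on A {N. N \<inter> B \<noteq> {}}"
    by (auto simp: upset_on_def)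
  show "Var ` B \<subseteq> supp_ideal A {N. N \<inter> B \<noteq> {}}"
    using assms by (auto simp: Var_def intro!: supp_ideal_single)
  fix m :: "'a \<Rightarrow>\<^sub>0 nat"
  assume m: "keys m \<subseteq> A" "keys m \<in> {N. N \<inter> B \<noteq> {}}"
  then obtain v where v: "v \<in> keys m" "v \<in> B"
    by auto
  have "m - single v 1 + single v 1 = m"
    using v diff_add_ind[of "{v}" m] by simp
  then have "single m 1 = single (m - single v 1) 1 * Var v"
    by (simp add: Var_def mult_single)
  moreover have "single (m - single v 1) 1 \<in> carrier (poly_ring A)"
    using m keys_diff_nat[of m "single v 1"] by (intro carrier_single) auto
  ultimately show "\<exists>q\<in>carrier (poly_ring A). \<exists>s\<in>Var ` B. single m 1 = q * s"
    using v by blast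
qed

text \<open>Dividing by x_z may remove z from the support of a monomial; N' must not notice this,
  hence its invariance under inserting z.\<close>

lemma Var_mult_supp_ideal:
  assumes "z \<in> A" and N: "\<And>G. G \<subseteq> A \<Longrightarrow> G \<in> N \<longleftrightarrow> z \<in> G \<and> G \<in> N'"
    and N': "\<And>G. insert z G \<in> N' \<longleftrightarrow> G \<in> N'"
  shows "(\<lambda>p. Var z * p) ` supp_ideal A N' = supp_ideal A N"
proof (intro subset_antisym subsetI)
  fix p :: "('a, 'b) mpoly"
  assume "p \<in> (\<lambda>p. Var z * p) ` supp_ideal A N'"
  then obtain q where q: "q \<in> supp_ideal A N'" "p = Var z * q"
    by blast
  show "p \<in> supp_ideal A N"
    unfolding supp_ideal_def
  proof (intro CollectI ballI)
    fix m
    assume "m \<in> keys p"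
    then obtain a b where "m = a + b" "a \<in> keys (Var z :: ('a, 'b) mpoly)" "b \<in> keys q"
      using keys_mult[of "Var z" q] q(2) by blast
    then have "keys m = insert z (keys b)" "keys b \<subseteq> A" "keys b \<in> N'"
      using q(1) by (auto simp: Var_def supp_ideal_def)
    then show "keys m \<subseteq> A \<and> keys m \<in> N"
      using assms by auto
  qed
next
  fix p :: "('a, 'b) mpoly"
  assume "p \<in> supp_ideal A N"
  then have "keys p \<subseteq> {m. keys m \<subseteq> A \<and> keys m \<in> N}"
    by (auto simp: supp_ideal_def)
  then have "\<exists>q\<in>supp_ideal A N'. p = Var z * q"
  proof (induction p rule: mpoly_induct)
    case zero
    show ?case
      by (rule bexI[of _ 0]) auto
  next
    case (single m c)
    then have m: "keys m \<subseteq> A" "z \<in> keys m" "keys m \<in> N'"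
      using N by auto
    define n where "n = m - single z 1"
    have nm: "single z 1 + n = m"
      using m diff_add_ind[of "{z}" m] by (simp add: n_def add.commute)
    then have "insert z (keys n) = keys m"
      by auto
    then have "keys n \<subseteq> A" "keys n \<in> N'"
      using m N' by (blast, metis)
    moreover have "single m c = Var z * single n c"
      using nm by (simp add: Var_def mult_single)
    ultimately show ?case
      by (intro bexI[of _ "single n c"] supp_ideal_single)
  next
    case (add p q)
    then show ?case
      by (metis distrib_left supp_ideal_add)
  qed
  then show "p \<in> (\<lambda>p. Var z * p) ` supp_ideal A N'"
    by blast
qed

text \<open>If the localization at A is zP with P nonzero, it is nonzero, so V is a nonface; and it
  does not contain the monomial of A - {z}, which z does not divide, so V - {z} is a face.
  Conversely, localize at the complement of the F from \<open>var_divisible_obtain\<close>.\<close>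

lemma ex_var_times_prime_iff:
  assumes sc: "simplicial_complex V \<Delta>"
  shows "(\<exists>A\<subseteq>V. var_times_prime A (mono_localization (SR_ideal V \<Delta> :: ('v, 'k::field) mpoly set) A))
    \<longleftrightarrow> var_divisible V \<Delta>"
proof
  note face = simplicial_complexD(2,3)[OF sc]
  assume "\<exists>A\<subseteq>V. var_times_prime A (mono_localization (SR_ideal V \<Delta> :: ('v, 'k) mpoly set) A)"
  then obtain A where A: "A \<subseteq> V"
    and "var_times_prime A (supp_ideal A {N. N \<union> (V - A) \<notin> \<Delta>} :: ('v, 'k) mpoly set)"
    by (metis mono_localization_eq[OF sc])
  from this(2) obtain z and P :: "('v, 'k) mpoly set" where z: "z \<in> A"
    and P: "monomial_prime A P \<and> P \<noteq> {0} \<and> Var z \<notin> P \<or> P = carrier (poly_ring A)"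
    and J: "supp_ideal A {N. N \<union> (V - A) \<notin> \<Delta>} = (\<lambda>p. Var z * p) ` P"
    unfolding var_times_prime_def by blast
  have fin: "finite (A - {z})"
    using A simplicial_complexD(5)[OF sc] by blast
  have "\<exists>p\<in>P. p \<noteq> 0"
    using P
  proof
    assume "P = carrier (poly_ring A)"
    then show ?thesis
      by (intro bexI[of _ 1]) auto
  next
    assume prime: "monomial_prime A P \<and> P \<noteq> {0} \<and> Var z \<notin> P"
    then have "0 \<in> P"
      by (auto simp: monomial_prime_def genideal_Var_eq)
    then show ?thesis
      using prime by auto
  qed
  then obtain p n where p: "p \<in> P" "lookup p n \<noteq> 0"
    by (metis poly_mapping_eqI lookup_zero)
  have "Var z * p \<in> supp_ideal A {N. N \<union> (V - A) \<notin> \<Delta>}"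
    using p J by blast
  have "lookup (Var z * p) (single z 1 + n) \<noteq> 0"
    using p by (simp add: Var_def lookup_single_mult lookup_add)
  then have "single z 1 + n \<in> keys (Var z * p)"
    unfolding in_keys_iff .
  then obtain N where N: "N \<subseteq> A" "N \<union> (V - A) \<notin> \<Delta>"
    using \<open>Var z * p \<in> _\<close> unfolding supp_ideal_def by blast
  have "N \<union> (V - A) \<subseteq> V"
    using N(1) A by blast
  then have V: "V \<notin> \<Delta>"
    using N(2) face(2) by metis
  have "V - {z} \<in> \<Delta>"
  proof (rule ccontr)
    assume "V - {z} \<notin> \<Delta>"
    moreover have "A - {z} \<union> (V - A) = V - {z}"
      using A z by auto
    ultimately have "single (ind (A - {z})) (1::'k) \<in> supp_ideal A {N. N \<union> (V - A) \<notin> \<Delta>}"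
      using fin by (intro supp_ideal_single) auto
    then obtain q where "single (ind (A - {z})) (1::'k) = Var z * q"
      using J by blast
    then have "lookup (Var z * q) (ind (A - {z})) = 1"
      by (metis lookup_single_eq)
    moreover have "\<not> (\<forall>v. lookup (single z 1) v \<le> lookup (ind (A - {z})) v)"
      using fin by (auto simp: lookup_ind intro!: exI[of _ z])
    ultimately show False
      unfolding Var_def lookup_single_mult by (metis zero_neq_one)
  qed
  then show "var_divisible V \<Delta>"
    using V A z by (auto simp: var_divisible_def)
next
  note face = simplicial_complexD(2,3)[OF sc]
  assume "var_divisible V \<Delta>"
  with sc obtain F i where F: "F \<in> \<Delta>" "i \<in> V - F"
    and cases: "(\<forall>G\<subseteq>V - F. G \<union> F \<in> \<Delta> \<longleftrightarrow> i \<notin> G) \<or>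
     insert i F \<noteq> V \<and> (\<forall>G\<subseteq>V - F. G \<union> F \<in> \<Delta> \<longleftrightarrow> i \<notin> G \<or> G = {i})"
    by (rule var_divisible_obtain)
  define A where "A = V - F"
  have A: "A \<subseteq> V" "V - A = F" "i \<in> A"
    using F face(1)[OF F(1)] by (auto simp: A_def)
  have "var_times_prime A (supp_ideal A {N. N \<union> F \<notin> \<Delta>} :: ('v, 'k) mpoly set)"
    using cases
  proof
    assume "\<forall>G\<subseteq>V - F. G \<union> F \<in> \<Delta> \<longleftrightarrow> i \<notin> G"
    then have "(\<lambda>p. Var i * p) ` supp_ideal A UNIV = (supp_ideal A {N. N \<union> F \<notin> \<Delta>} :: ('v, 'k) mpoly set)"
      using A by (intro Var_mult_supp_ideal) (auto simp: A_def)
    moreover have "supp_ideal A UNIV = (carrier (poly_ring A) :: ('v, 'k) mpoly set)"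
      by (simp add: supp_ideal_def poly_ring_def)
    ultimately show ?thesis
      using A unfolding var_times_prime_def by metis
  next
    assume asm: "insert i F \<noteq> V \<and> (\<forall>G\<subseteq>V - F. G \<union> F \<in> \<Delta> \<longleftrightarrow> i \<notin> G \<or> G = {i})"
    \<comment> \<open>G \<union> F is a nonface iff G contains i and a further element of A, so the
      cofactor of x_i is the prime generated by the remaining variables.\<close>
    define P where "P = (supp_ideal A {N. N \<inter> (A - {i}) \<noteq> {}} :: ('v, 'k) mpoly set)"
    have "monomial_prime A P"
      unfolding monomial_prime_def P_def by (intro exI[of _ "A - {i}"]) (auto simp: genideal_Var_eq)
    moreover have "P \<noteq> {0}"
    proof -
      obtain j where j: "j \<in> A - {i}"
        using asm F face(1)[OF F(1)] by (auto simp: A_def)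
      then have "single (single j 1) 1 \<in> P"
        unfolding P_def by (intro supp_ideal_single) auto
      moreover have "single (single j 1) (1::'k) \<noteq> 0"
        by (metis lookup_single_eq lookup_zero zero_neq_one)
      ultimately show ?thesis
        by blast
    qed
    moreover have "Var i \<notin> P"
      by (auto simp: P_def supp_ideal_def Var_def)
    moreover have "(\<lambda>p. Var i * p) ` P = supp_ideal A {N. N \<union> F \<notin> \<Delta>}"
      unfolding P_def
    proof (rule Var_mult_supp_ideal[OF A(3)])
      fix G
      assume "G \<subseteq> A"
      then show "G \<in> {N. N \<union> F \<notin> \<Delta>} \<longleftrightarrow> i \<in> G \<and> G \<in> {N. N \<inter> (A - {i}) \<noteq> {}}"
        using asm unfolding A_def by auto
    qed auto
    ultimately show ?thesis
      using A unfolding var_times_prime_def by metis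
  qed
  then show "\<exists>A\<subseteq>V. var_times_prime A (mono_localization (SR_ideal V \<Delta> :: ('v, 'k) mpoly set) A)"
    using A by (intro exI[of _ A]) (simp add: mono_localization_eq[OF sc])
qed

lemma SR_ideal_eq_0:
  assumes "simplicial_complex V \<Delta>" "V \<in> \<Delta>"
  shows "SR_ideal V \<Delta> = {0}"
proof -
  have "p = 0" if "p \<in> supp_ideal V (- \<Delta>)" for p :: "('a, 'b) mpoly"
  proof (rule poly_mapping_eqI)
    fix m
    have "m \<notin> keys p"
      using that simplicial_complexD(3)[OF assms] by (auto simp: supp_ideal_def)
    then show "lookup p m = lookup 0 m"
      by (simp add: in_keys_iff)
  qed
  then show ?thesis
    unfolding SR_ideal_eq[OF assms(1)] by auto
qed

theorem theorem2p10:
  fixes V1 V2 :: "'v set" and \<Delta>1 \<Delta>2 :: "'v set set"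
  assumes "simplicial_complex V1 \<Delta>1" and "simplicial_complex V2 \<Delta>2" and "V1 \<inter> V2 = {}"
  shows
    "(rigid TYPE('k::field) (V1 \<union> V2) (circ V1 \<Delta>1 V2 \<Delta>2) \<and>
      (SR_ideal V1 \<Delta>1 :: ('v, 'k) mpoly set) \<noteq> {0} \<and>
      (SR_ideal V2 \<Delta>2 :: ('v, 'k) mpoly set) \<noteq> {0}
        \<longrightarrow> rigid TYPE('k) V1 \<Delta>1 \<and> rigid TYPE('k) V2 \<Delta>2)
     \<and>
     (rigid TYPE('k) V1 \<Delta>1 \<and> rigid TYPE('k) V2 \<Delta>2
        \<longrightarrow>
        (rigid TYPE('k) (V1 \<union> V2) (circ V1 \<Delta>1 V2 \<Delta>2)
          \<longleftrightarrow> (\<forall>F\<in>\<Delta>1. \<not> special (V1 - F) (link \<Delta>1 F)) \<or>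
              (\<forall>F\<in>\<Delta>2. \<not> special (V2 - F) (link \<Delta>2 F)))
        \<and>
        ((\<forall>F\<in>\<Delta>1. \<not> special (V1 - F) (link \<Delta>1 F)) \<or>
         (\<forall>F\<in>\<Delta>2. \<not> special (V2 - F) (link \<Delta>2 F))
          \<longleftrightarrow>
         (\<forall>A\<subseteq>V1. \<not> var_times_prime A
             (mono_localization (SR_ideal V1 \<Delta>1 :: ('v, 'k) mpoly set) A)) \<or>
         (\<forall>A\<subseteq>V2. \<not> var_times_prime A
             (mono_localization (SR_ideal V2 \<Delta>2 :: ('v, 'k) mpoly set) A))))"
proof -
  note sc = assms(1,2) and disj = assms(3)
  have disj': "V2 \<inter> V1 = {}"
    using disj by auto
  \<comment> \<open>The results on the circ single out one of the two complexes; commutativity of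
    the circ yields their mirror images.\<close>
  have comm: "circ V2 \<Delta>2 V1 \<Delta>1 = circ V1 \<Delta>1 V2 \<Delta>2" "V2 \<union> V1 = V1 \<union> V2"
    by (rule circ_commute) (rule Un_commute)
  have rigid1: "rigid TYPE('k) V1 \<Delta>1 \<longleftrightarrow> comb_rigid TYPE('k) V1 \<Delta>1"
    and rigid2: "rigid TYPE('k) V2 \<Delta>2 \<longleftrightarrow> comb_rigid TYPE('k) V2 \<Delta>2"
    and rigid12: "rigid TYPE('k) (V1 \<union> V2) (circ V1 \<Delta>1 V2 \<Delta>2) \<longleftrightarrow>
      comb_rigid TYPE('k) (V1 \<union> V2) (circ V1 \<Delta>1 V2 \<Delta>2)"
    by (intro rigid_iff_comb_rigid simplicial_complex_circ sc)+
  have nz1: "(SR_ideal V1 \<Delta>1 :: ('v, 'k) mpoly set) \<noteq> {0} \<Longrightarrow> V1 \<notin> \<Delta>1"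
    and nz2: "(SR_ideal V2 \<Delta>2 :: ('v, 'k) mpoly set) \<noteq> {0} \<Longrightarrow> V2 \<notin> \<Delta>2"
    using SR_ideal_eq_0[OF sc(1)] SR_ideal_eq_0[OF sc(2)] by blast+
  have special1: "(\<forall>F\<in>\<Delta>1. \<not> special (V1 - F) (link \<Delta>1 F)) \<longleftrightarrow> \<not> var_divisible V1 \<Delta>1"
    and special2: "(\<forall>F\<in>\<Delta>2. \<not> special (V2 - F) (link \<Delta>2 F)) \<longleftrightarrow> \<not> var_divisible V2 \<Delta>2"
    using ex_special_link_iff[OF sc(1)] ex_special_link_iff[OF sc(2)] by blast+
  have prime1: "(\<forall>A\<subseteq>V1. \<not> var_times_prime A
      (mono_localization (SR_ideal V1 \<Delta>1 :: ('v, 'k) mpoly set) A)) \<longleftrightarrow> \<not> var_divisible V1 \<Delta>1"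
    and prime2: "(\<forall>A\<subseteq>V2. \<not> var_times_prime A
      (mono_localization (SR_ideal V2 \<Delta>2 :: ('v, 'k) mpoly set) A)) \<longleftrightarrow> \<not> var_divisible V2 \<Delta>2"
    using ex_var_times_prime_iff[OF sc(1), where 'k = 'k] ex_var_times_prime_iff[OF sc(2), where 'k = 'k]
    by blast+
  show ?thesis
    unfolding rigid1 rigid2 rigid12 special1 special2 prime1 prime2
    using nz1 nz2 comb_rigid_circ_imp_comb_rigid[OF disj, of \<Delta>2 \<Delta>1, where 'k = 'k]
      comb_rigid_circ_imp_comb_rigid[OF disj', of \<Delta>1 \<Delta>2, where 'k = 'k, unfolded comm]
      var_divisible_imp_not_comb_rigid_circ[OF disj sc, where 'k = 'k]
      comb_rigid_circ[OF disj sc, where 'k = 'k]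
      comb_rigid_circ[OF disj' sc(2,1), where 'k = 'k, unfolded comm]
    by blast
qed

end
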